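(* Let $G_3(\alpha,\beta)=(\alpha^2+\beta^2+6\alpha\beta)^2-16\alpha\beta\left(4(1+\alpha\beta)-3(\alpha+\beta)\right)^2$. Then for all $p\in\mathbb{C}$ with $0<|p|$ sufficiently small, \[\mathrm{m}\!\left(G_3\!\left(\frac{(x+x^{-1})^2(y+y^{-1})^2}{16},\ \frac1p\left(\frac{1+2p}{2+p}\right)^3\right)\right)=-16\log 2-16\,\mu\!\left(p\left(\frac{2+p}{1+2p}\right)^3\right)+8\,\mu\!\left(p^3\,\frac{2+p}{1+2p}\right).\]
   Context: $\mathrm{m}(P)=\int_0^1\int_0^1\log|P(e^{2\pi i\theta_1},e^{2\pi i\theta_2})|d\theta_1d\theta_2$ is the logarithmic Mahler measure of a Laurent polynomial in $x,y$; $\mu(t)=\mathrm{m}\!\left(\frac{4}{\sqrt t}+x+\frac1x+y+\frac1y\right)$. *)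

theory Defs
  imports "HOL-Analysis.Analysis"
begin

definition mahler2 :: "(complex \<Rightarrow> complex \<Rightarrow> complex) \<Rightarrow> real" where
  "mahler2 P = (LINT t : ({0..1} \<times> {0..1}) | lborel.
      ln (cmod (P (cis (2 * pi * fst t)) (cis (2 * pi * snd t)))))"

text \<open>mu(t) = m(4/sqrt t + x + 1/x + y + 1/y), principal square root
(the choice of branch does not affect the value).\<close>
definition mu :: "complex \<Rightarrow> real" where
  "mu t = mahler2 (\<lambda>x y. 4 / csqrt t + x + inverse x + y + inverse y)"

definition G3 :: "complex \<Rightarrow> complex \<Rightarrow> complex" where
  "G3 a b = (a^2 + b^2 + 6*a*b)^2 - 16*a*b*(4*(1 + a*b) - 3*(a + b))^2"

end

theory Submission
  imports Defs "HOL-Complex_Analysis.Complex_Analysis"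
begin

text \<open>
  Put \<open>t = p ((2 + p) / (1 + 2p))^3\<close> and \<open>v = p^3 (2 + p) / (1 + 2p)\<close>, and let
  \<open>H(z)\<close> be the mean of \<open>Log (1 - z a)\<close> over the torus, where
  \<open>a = cos^2 \<theta>\<^sub>1 cos^2 \<theta>\<^sub>2\<close>. Since \<open>a\<close> and \<open>((cos \<theta>\<^sub>1 + cos \<theta>\<^sub>2) / 2)^2\<close> have the
  same moments, \<open>mu(t) = log 4 - log |t| / 2 + Re H(t) / 2\<close>. The reciprocal symmetry of \<open>G3\<close> gives
  \<open>G3(a, 1/t) = t^(-4) (1 - a v) \<Prod>\<^sub>j (1 - a u\<^sub>j)\<close>, where \<open>v, u\<^sub>1, u\<^sub>2, u\<^sub>3\<close> are the roots of
  \<open>G3(\<cdot>, t)\<close>, so the claim becomes a relation of Hecke type between \<open>\<Sum>\<^sub>j H(u\<^sub>j)\<close>,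
  \<open>H(v)\<close> and \<open>H(t)\<close>. Its derivative involves only \<open>f = 2F1(1/2, 1/2; 1; -)\<close>, because
  \<open>z H'(z) = 1 - f(z)\<close>. Ramanujan's cubic transformation expresses all values of \<open>f\<close>
  through \<open>f(v)\<close>, and what remains is an identity between rational functions.
\<close>

subsection \<open>Moments of the cosine on the torus\<close>

text \<open>The obstacle: \<open>u\<^sub>1\<close>, \<open>u\<^sub>2\<close>,
  \<open>u\<^sub>3\<close> are branches of size about |p|^(1/3), not power series in p. They become
  single-valued in a cube root s of t, so the relation is proved on a disc in s and carried over to
  p at the end. Small p keeps t, v and all \<open>u\<^sub>j\<close> inside the unit disc, where the
  logarithms expand. Origin of the relation: if t has nome q, then v has nome q^3 and the
  \<open>u\<^sub>j\<close> have the three cube roots of q as nomes. The derivative q d/dq of log t -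
  H(t) is the Eisenstein series 1 - 4 Sum a_n q^n of weight 3, where a_n is the sum of chi(d) d^2
  over d | n and chi is the odd character mod 4. Its eigenvalue under the Hecke operator at 3 is 1 +
  9 chi(3) = -8. Integration divides the n-th coefficient by n, so that H(t) gets the coefficient -8
  and H(v) gets 9/3 = 3. Since the product of v and the \<open>u\<^sub>j\<close> is t^4, the
  logarithms add up to 4 log (t^3 / v) plus a constant. The proof verifies all this without
  nomes.\<close>

abbreviation unit_square :: "(real \<times> real) set" where
  "unit_square \<equiv> {0..1} \<times> {0..1}"

lemma set_integrable_unit_square:
  fixes f :: "real \<times> real \<Rightarrow> 'a :: {banach, second_countable_topology}"
  assumes "continuous_on unit_square f"
  shows "set_integrable lborel unit_square f"
  unfolding set_integrable_def
  by (intro borel_integrable_compact assms compact_Times compact_Icc)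

lemma set_integral_unit_square_mult:
  fixes f g :: "real \<Rightarrow> real"
  assumes f: "continuous_on {0..1} f" and g: "continuous_on {0..1} g"
  shows "(LINT t:unit_square|lborel. f (fst t) * g (snd t)) =
         (LINT x:{0..1}|lborel. f x) * (LINT y:{0..1}|lborel. g y)"
proof -
  define F where "F = (\<lambda>x y. (indicator {0..1} x * f x) * (indicator {0..1} y * g y) :: real)"
  have "continuous_on unit_square (\<lambda>t. f (fst t) * g (snd t))"
    by (intro continuous_intros continuous_on_compose2[OF f] continuous_on_compose2[OF g]) auto
  from set_integrable_unit_square[OF this]
  have "integrable lborel (\<lambda>t. indicator unit_square t * (f (fst t) * g (snd t)))"
    by (simp add: set_integrable_def)
  moreover have eq: "(\<lambda>t. indicator unit_square t * (f (fst t) * g (snd t))) = (\<lambda>(x, y). F x y)"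
    by (auto simp: F_def indicator_times fun_eq_iff split: split_indicator)
  ultimately have int: "integrable (lborel \<Otimes>\<^sub>M lborel) (\<lambda>(x, y). F x y)"
    by (simp add: lborel_prod)
  have "(LINT t:unit_square|lborel. f (fst t) * g (snd t)) = integral\<^sup>L (lborel \<Otimes>\<^sub>M lborel) (\<lambda>(x, y). F x y)"
    by (simp add: set_lebesgue_integral_def eq lborel_prod)
  also have "\<dots> = (\<integral>x. (\<integral>y. F x y \<partial>lborel) \<partial>lborel)"
    by (rule lborel_pair.integral_fst[OF int, symmetric])
  also have "\<dots> = (LINT x:{0..1}|lborel. f x) * (LINT y:{0..1}|lborel. g y)"
    by (simp add: F_def set_lebesgue_integral_def)
  finally show ?thesis .
qed

definition cos_moment :: "nat \<Rightarrow> real" where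
  "cos_moment m = (LINT x:{0..1}|lborel. cos (2 * pi * x) ^ m)"

lemma set_integrable_cos_power: "set_integrable lborel {0..1} (\<lambda>x::real. cos (2 * pi * x) ^ m)"
  unfolding set_integrable_def by (intro borel_integrable_compact continuous_intros compact_Icc)

lemma cos_moment_0: "cos_moment 0 = 1"
  by (simp add: cos_moment_def set_lebesgue_integral_def)

lemma cos_moment_1: "cos_moment 1 = 0"
proof -
  have "(\<integral>x. indicator {0..1} x *\<^sub>R cos (2 * pi * x) \<partial>lborel) =
        sin (2 * pi * 1) / (2 * pi) - sin (2 * pi * 0) / (2 * pi)"
    by (rule integral_FTC_atLeastAtMost)
       (auto intro!: continuous_intros derivative_eq_intros
             simp flip: has_real_derivative_iff_has_vector_derivative)
  then show ?thesis by (simp add: cos_moment_def set_lebesgue_integral_def)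
qed

text \<open>Wallis recurrence by parts: the derivative of \<open>cos ^ (m + 1) * sin\<close>
  integrates to 0 over a full period, and replacing sin^2 by 1 - cos^2 leaves a combination of the
  two moments.\<close>

lemma cos_moment_Suc_Suc: "real (m + 2) * cos_moment (m + 2) = real (m + 1) * cos_moment m"
proof -
  let ?F = "\<lambda>x::real. cos (2 * pi * x) ^ (m + 1) * sin (2 * pi * x) / (2 * pi)"
  let ?f = "\<lambda>x::real. real (m + 2) * cos (2 * pi * x) ^ (m + 2) - real (m + 1) * cos (2 * pi * x) ^ m"
  have D: "(?F has_real_derivative ?f x) (at x within S)" for x S
  proof -
    have s: "sin (2 * pi * x) * sin (2 * pi * x) = 1 - cos (2 * pi * x) * cos (2 * pi * x)"
      using sin_cos_squared_add3[of "2 * pi * x"] by linarith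
    have "(?F has_real_derivative
        (real (m + 1) * (cos (2 * pi * x) ^ m * (- sin (2 * pi * x) * (2 * pi))) * sin (2 * pi * x)
          + cos (2 * pi * x) ^ (m + 1) * (cos (2 * pi * x) * (2 * pi))) / (2 * pi)) (at x within S)"
    proof -
      have "((\<lambda>x. cos (2 * pi * x)) has_real_derivative - sin (2 * pi * x) * (2 * pi)) (at x within S)"
        by (auto intro!: derivative_eq_intros)
      from DERIV_power_Suc[OF this, of m]
      have pw: "((\<lambda>x. cos (2 * pi * x) ^ (m + 1)) has_real_derivative
          real (m + 1) * (cos (2 * pi * x) ^ m * (- sin (2 * pi * x) * (2 * pi)))) (at x within S)"
        by (simp add: mult_ac)
      show ?thesis by (rule derivative_eq_intros pw refl | simp)+ (simp add: field_simps)
    qed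
    also have "(real (m + 1) * (cos (2 * pi * x) ^ m * (- sin (2 * pi * x) * (2 * pi))) * sin (2 * pi * x)
          + cos (2 * pi * x) ^ (m + 1) * (cos (2 * pi * x) * (2 * pi))) / (2 * pi) =
        - real (m + 1) * cos (2 * pi * x) ^ m * (sin (2 * pi * x) * sin (2 * pi * x))
          + cos (2 * pi * x) ^ (m + 2)"
      by (simp add: field_simps power_add power2_eq_square)
    also have "\<dots> = ?f x"
      unfolding s by (simp add: algebra_simps power_add power2_eq_square)
    finally show ?thesis .
  qed
  have "(\<integral>x. indicator {0..1} x *\<^sub>R ?f x \<partial>lborel) = ?F 1 - ?F 0"
    by (rule integral_FTC_atLeastAtMost)
       (use D in \<open>auto intro!: continuous_intros simp flip: has_real_derivative_iff_has_vector_derivative\<close>)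
  then have "(LINT x:{0..1}|lborel. ?f x) = 0"
    by (simp add: set_lebesgue_integral_def)
  also have "(LINT x:{0..1}|lborel. ?f x) = real (m + 2) * cos_moment (m + 2) - real (m + 1) * cos_moment m"
    unfolding cos_moment_def
    by (simp only: set_integral_diff set_integrable_mult_right set_integrable_cos_power set_integral_mult_right)
  finally show ?thesis by simp
qed

lemma cos_moment_odd: "cos_moment (2 * n + 1) = 0"
proof (induction n)
  case (Suc n)
  then show ?case using cos_moment_Suc_Suc[of "2 * n + 1"] by simp
qed (simp add: cos_moment_1[simplified])

lemma cos_moment_even: "cos_moment (2 * n) = real ((2 * n) choose n) / 4 ^ n"
proof -
  have fact: "cos_moment (2 * n) = fact (2 * n) / (4 ^ n * fact n ^ 2)"
  proof (induction n)
    case (Suc n)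
    have "cos_moment (2 * Suc n) = (2 * real n + 1) / (2 * real n + 2) * cos_moment (2 * n)"
      using cos_moment_Suc_Suc[of "2 * n"] by (simp add: field_simps)
    also have "\<dots> = fact (2 * Suc n) / (4 ^ Suc n * fact (Suc n) ^ 2)"
      unfolding Suc by (simp add: divide_simps power2_eq_square) (simp add: algebra_simps)
    finally show ?case .
  qed (simp add: cos_moment_0)
  have "real ((2 * n) choose n) = fact (2 * n) / (fact n * fact n)"
    by (subst binomial_fact) auto
  with fact show ?thesis by (simp add: power2_eq_square)
qed

text \<open>These are ((1/2)_n / n!)^2, the Taylor coefficients of 2F1(1/2, 1/2; 1; z), which is 2 K
  / pi for the complete elliptic integral K with squared modulus z.\<close>

definition modulus_coeff :: "nat \<Rightarrow> real" where
  "modulus_coeff n = (real ((2 * n) choose n) / 4 ^ n)\<^sup>2"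

text \<open>The hypergeometric differential equation on the level of coefficients;
  \<open>hyp_ode\<close> rests on it.\<close>

lemma modulus_coeff_rec: "(real n + 1)\<^sup>2 * modulus_coeff (Suc n) = (real n + 1 / 2)\<^sup>2 * modulus_coeff n"
proof -
  have m: "modulus_coeff k = (cos_moment (2 * k))\<^sup>2" for k
    by (simp add: modulus_coeff_def cos_moment_even)
  have "(real n + 1) * cos_moment (2 * Suc n) = (real n + 1 / 2) * cos_moment (2 * n)"
    using cos_moment_Suc_Suc[of "2 * n"] by (simp add: field_simps)
  then show ?thesis unfolding m by (metis power_mult_distrib)
qed

lemma modulus_coeff_0 [simp]: "modulus_coeff 0 = 1"
  by (simp add: modulus_coeff_def)

lemma modulus_coeff_bounds: "0 \<le> modulus_coeff n" "modulus_coeff n \<le> 1"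
proof -
  show "0 \<le> modulus_coeff n" by (simp add: modulus_coeff_def)
  have "real ((2 * n) choose n) \<le> 4 ^ n"
  proof -
    have "(2 * n) choose n \<le> 2 ^ (2 * n)" by (rule binomial_le_pow2)
    then have "real ((2 * n) choose n) \<le> real (2 ^ (2 * n))" by (rule of_nat_mono)
    then show ?thesis by (simp add: power_mult)
  qed
  then show "modulus_coeff n \<le> 1"
    unfolding modulus_coeff_def by (intro power_le_one) auto
qed

lemma moment_cos_prod:
  "(LINT t:unit_square|lborel. ((cos (2 * pi * fst t))\<^sup>2 * (cos (2 * pi * snd t))\<^sup>2) ^ n) = modulus_coeff n"
proof -
  have "(LINT t:unit_square|lborel. ((cos (2 * pi * fst t))\<^sup>2 * (cos (2 * pi * snd t))\<^sup>2) ^ n) =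
        (LINT t:unit_square|lborel. cos (2 * pi * fst t) ^ (2 * n) * cos (2 * pi * snd t) ^ (2 * n))"
    by (simp add: power_mult_distrib power_mult)
  also have "\<dots> = cos_moment (2 * n) * cos_moment (2 * n)"
    unfolding cos_moment_def by (intro set_integral_unit_square_mult continuous_intros)
  finally show ?thesis by (simp add: cos_moment_even modulus_coeff_def power2_eq_square)
qed

lemma moment_cos_sum:
  "(LINT t:unit_square|lborel. (cos (2 * pi * fst t) + cos (2 * pi * snd t)) ^ m) =
    (\<Sum>k\<le>m. real (m choose k) * (cos_moment k * cos_moment (m - k)))"
proof -
  have "(LINT t:unit_square|lborel. (cos (2 * pi * fst t) + cos (2 * pi * snd t)) ^ m) =
     (LINT t:unit_square|lborel. (\<Sum>k\<le>m. real (m choose k) * (cos (2 * pi * fst t) ^ k * cos (2 * pi * snd t) ^ (m - k))))"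
    by (simp add: binomial_ring mult.assoc)
  also have "\<dots> = (\<Sum>k\<le>m. LINT t:unit_square|lborel. real (m choose k) * (cos (2 * pi * fst t) ^ k * cos (2 * pi * snd t) ^ (m - k)))"
    unfolding set_lebesgue_integral_def scaleR_sum_right
    by (intro Bochner_Integration.integral_sum borel_integrable_compact continuous_intros compact_Times compact_Icc)
  also have "\<dots> = (\<Sum>k\<le>m. real (m choose k) * (cos_moment k * cos_moment (m - k)))"
    unfolding cos_moment_def set_integral_mult_right
    by (intro sum.cong refl arg_cong2[of _ _ _ _ "(*)"] set_integral_unit_square_mult continuous_intros)
  finally show ?thesis .
qed

lemma moment_cos_sum_odd:
  "(LINT t:unit_square|lborel. (cos (2 * pi * fst t) + cos (2 * pi * snd t)) ^ (2 * n + 1)) = 0"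
proof -
  have "cos_moment k * cos_moment (2 * n + 1 - k) = 0" if "k \<le> 2 * n + 1" for k
  proof (cases "even k")
    case True
    then obtain j where "k = 2 * j" by (elim evenE)
    with that have "2 * n + 1 - k = 2 * (n - j) + 1" by simp
    then show ?thesis by (simp only: cos_moment_odd)
  next
    case False
    then obtain j where "k = 2 * j + 1" by (elim oddE)
    then show ?thesis by (simp only: cos_moment_odd)
  qed
  then show ?thesis unfolding moment_cos_sum by (intro sum.neutral) auto
qed

text \<open>Only even exponents 2j and 2i with i + j = n contribute. Writing the binomials as
  factorials turns such a term into C(2n, n) / 4^n times C(n, j)^2, and the squares C(n, j)^2 sum to
  C(2n, n). Hence the half sum of two cosines has 2n-th moment
  \<open>modulus_coeff n\<close>.\<close>

lemma moment_cos_sum_even: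
  "(LINT t:unit_square|lborel. (cos (2 * pi * fst t) + cos (2 * pi * snd t)) ^ (2 * n)) = 4 ^ n * modulus_coeff n"
proof -
  let ?g = "\<lambda>k. real ((2 * n) choose k) * (cos_moment k * cos_moment (2 * n - k))"
  have "(\<Sum>k\<le>2 * n. ?g k) = (\<Sum>k\<in>(\<lambda>j. 2 * j) ` {..n}. ?g k)"
  proof (rule sum.mono_neutral_right)
    show "\<forall>k\<in>{..2 * n} - (\<lambda>j. 2 * j) ` {..n}. ?g k = 0"
    proof
      fix k assume k: "k \<in> {..2 * n} - (\<lambda>j. 2 * j) ` {..n}"
      have "odd k"
      proof
        assume "even k"
        then obtain j where "k = 2 * j" by (elim evenE)
        with k show False by auto
      qed
      then obtain j where "k = 2 * j + 1" by (elim oddE)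
      then show "?g k = 0" by (simp only: cos_moment_odd)
    qed
  qed auto
  also have "\<dots> = (\<Sum>j\<le>n. ?g (2 * j))"
    by (subst sum.reindex) (auto simp: inj_on_def)
  also have "\<dots> = (\<Sum>j\<le>n. real ((2 * n) choose n) / 4 ^ n * real (n choose j) ^ 2)"
  proof (rule sum.cong[OF refl])
    fix j assume "j \<in> {..n}"
    then obtain i where n: "n = j + i" by (auto simp: le_iff_add)
    have f: "real ((2 * k) choose k) = fact (2 * k) / (fact k * fact k)" for k :: nat
      by (subst binomial_fact) auto
    have "real ((2 * n) choose (2 * j)) = fact (2 * n) / (fact (2 * j) * fact (2 * i))"
      by (subst binomial_fact) (auto simp: n algebra_simps)
    moreover have "2 * n - 2 * j = 2 * i" by (simp add: n)
    ultimately have "?g (2 * j) = fact (2 * n) / (fact (2 * j) * fact (2 * i)) * (cos_moment (2 * j) * cos_moment (2 * i))"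
      by simp
    also have "\<dots> = fact (2 * n) / (4 ^ n * (fact j)\<^sup>2 * (fact i)\<^sup>2)"
      unfolding cos_moment_even f by (simp add: n power_add field_simps power2_eq_square)
    also have "\<dots> = real ((2 * n) choose n) / 4 ^ n * (fact n / (fact j * fact i))\<^sup>2"
      unfolding f by (simp add: field_simps power2_eq_square)
    also have "fact n / (fact j * fact i) = real (n choose j)"
      by (subst binomial_fact) (auto simp: n)
    finally show "?g (2 * j) = real ((2 * n) choose n) / 4 ^ n * real (n choose j) ^ 2" .
  qed
  also have "\<dots> = real ((2 * n) choose n) / 4 ^ n * real (\<Sum>j\<le>n. (n choose j)\<^sup>2)"
    by (simp add: sum_distrib_left)
  also have "\<dots> = 4 ^ n * modulus_coeff n"
    unfolding choose_square_sum modulus_coeff_def by (simp add: power2_eq_square)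
  finally show ?thesis unfolding moment_cos_sum .
qed

text \<open>On the square, \<open>z * X t\<close> stays in the disc of radius |z| < 1, so the series
  of Log (1 - z X) is dominated by a geometric series and may be integrated term by term. The
  integral therefore depends on X only through its moments.\<close>

lemma integral_ln_one_minus:
  fixes X :: "real \<times> real \<Rightarrow> real" and z :: complex
  assumes cont: "continuous_on unit_square X"
    and bound: "\<And>t. t \<in> unit_square \<Longrightarrow> \<bar>X t\<bar> \<le> 1" and z: "cmod z < 1"
  shows "set_integrable lborel unit_square (\<lambda>t. ln (cmod (1 - z * X t)))"
    and "(LINT t:unit_square|lborel. ln (cmod (1 - z * X t))) =
         Re (\<Sum>n. - of_real (LINT t:unit_square|lborel. X t ^ n) * z ^ n / of_nat n)"
proof -
  have zX: "cmod (z * X t) < 1" if "t \<in> unit_square" for t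
  proof -
    have "cmod (z * X t) \<le> cmod z * 1"
      unfolding norm_mult using bound[OF that] by (intro mult_left_mono) auto
    with z show ?thesis by simp
  qed
  then have nz: "1 - z * X t \<noteq> 0" if "t \<in> unit_square" for t
    using that by fastforce
  show "set_integrable lborel unit_square (\<lambda>t. ln (cmod (1 - z * X t)))"
    by (intro set_integrable_unit_square continuous_intros cont) (use nz in auto)
  \<comment> \<open>The term n = 0 is a quotient by 0, hence 0, so the logarithmic series may start
    at n = 0.\<close>
  define f where "f = (\<lambda>n t. indicator unit_square t *\<^sub>R (- ((z * X t) ^ n) / of_nat n))"
  have norm_f: "norm (f n t) \<le> cmod z ^ n" for n t
  proof (cases "t \<in> unit_square")
    case True
    have "norm (f n t) = cmod z ^ n * \<bar>X t\<bar> ^ n / real n"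
      using True by (simp add: f_def norm_divide norm_power norm_mult power_mult_distrib)
    also have "\<dots> \<le> cmod z ^ n * 1 / 1"
    proof (cases "n = 0")
      case False
      then show ?thesis using bound[OF True]
        by (intro frac_le mult_left_mono mult_nonneg_nonneg power_le_one) auto
    qed auto
    finally show ?thesis by simp
  qed (simp add: f_def)
  have int_f: "integrable lborel (f n)" for n
    unfolding f_def divide_inverse by (intro borel_integrable_compact compact_Times compact_Icc continuous_intros cont)
  have sum_f: "(\<Sum>n. f n t) = indicator unit_square t *\<^sub>R Ln (1 - z * X t)" for t
  proof (cases "t \<in> unit_square")
    case True
    then show ?thesis using Ln_series'[of "- (z * X t)"] zX[OF True]
      by (simp add: f_def sums_iff)
  qed (simp add: f_def)
  have geo: "summable (\<lambda>n. cmod z ^ n)" using z by (simp add: summable_geometric)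
  have summable_int: "summable (\<lambda>n. \<integral>t. norm (f n t) \<partial>lborel)"
  proof (rule summable_comparison_test'[OF geo, of 0])
    fix n :: nat
    have "(\<integral>t. norm (f n t) \<partial>lborel) \<le> (\<integral>t. indicator unit_square t *\<^sub>R cmod z ^ n \<partial>lborel)"
    proof (rule integral_mono)
      show "integrable lborel (\<lambda>t. indicator unit_square t *\<^sub>R cmod z ^ n)"
        by (intro borel_integrable_compact compact_Times compact_Icc continuous_intros)
      show "norm (f n t) \<le> indicator unit_square t *\<^sub>R cmod z ^ n" for t
        using norm_f[of n t] by (cases "t \<in> unit_square") (auto simp: f_def)
    qed (use int_f in auto)
    also have "\<dots> = cmod z ^ n * (LINT t:unit_square|lborel. 1 * 1)"
      by (simp add: set_lebesgue_integral_def)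
    also have "\<dots> = cmod z ^ n"
      by (subst set_integral_unit_square_mult) (auto simp: set_lebesgue_integral_def)
    finally show "norm (\<integral>t. norm (f n t) \<partial>lborel) \<le> cmod z ^ n" by simp
  qed
  have sm: "AE t in lborel. summable (\<lambda>n. norm (f n t))"
    using norm_f by (intro AE_I2 summable_comparison_test'[OF geo, of 0]) auto
  have int_sum: "integrable lborel (\<lambda>t. indicator unit_square t *\<^sub>R Ln (1 - z * X t))"
    using integrable_suminf[OF int_f sm summable_int] by (simp add: sum_f)
  have "(\<integral>t. indicator unit_square t *\<^sub>R Ln (1 - z * X t) \<partial>lborel) = (\<Sum>n. integral\<^sup>L lborel (f n))"
    using integral_suminf[OF int_f sm summable_int] by (simp add: sum_f)
  also have "(\<lambda>n. integral\<^sup>L lborel (f n)) = (\<lambda>n. - of_real (LINT t:unit_square|lborel. X t ^ n) * z ^ n / of_nat n)"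
  proof
    fix n
    have "f n = (\<lambda>t. (- (z ^ n) / of_nat n) * of_real (indicator unit_square t * X t ^ n))"
      by (auto simp: f_def fun_eq_iff power_mult_distrib scaleR_conv_of_real)
    then have "integral\<^sup>L lborel (f n) = (- (z ^ n) / of_nat n) * of_real (\<integral>t. indicator unit_square t * X t ^ n \<partial>lborel)"
      by (simp del: of_real_mult)
    then show "integral\<^sup>L lborel (f n) = - of_real (LINT t:unit_square|lborel. X t ^ n) * z ^ n / of_nat n"
      by (simp add: set_lebesgue_integral_def)
  qed
  finally have I: "(\<integral>t. indicator unit_square t *\<^sub>R Ln (1 - z * X t) \<partial>lborel) =
      (\<Sum>n. - of_real (LINT t:unit_square|lborel. X t ^ n) * z ^ n / of_nat n)" .
  have "(LINT t:unit_square|lborel. ln (cmod (1 - z * X t))) =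
        (\<integral>t. Re (indicator unit_square t *\<^sub>R Ln (1 - z * X t)) \<partial>lborel)"
    unfolding set_lebesgue_integral_def
    by (intro Bochner_Integration.integral_cong refl) (use nz in \<open>auto split: split_indicator\<close>)
  also have "\<dots> = Re (\<integral>t. indicator unit_square t *\<^sub>R Ln (1 - z * X t) \<partial>lborel)"
    by (rule integral_Re[OF int_sum])
  finally show "(LINT t:unit_square|lborel. ln (cmod (1 - z * X t))) =
         Re (\<Sum>n. - of_real (LINT t:unit_square|lborel. X t ^ n) * z ^ n / of_nat n)"
    unfolding I .
qed

subsection \<open>The hypergeometric function and its logarithmic primitive\<close>

definition hyp_fps :: "complex fps" where
  "hyp_fps = Abs_fps (\<lambda>n. of_real (modulus_coeff n))"

text \<open>Taylor series of H. Its constant term is a quotient by 0 and so vanishes, as Log 1 = 0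
  demands.\<close>

definition log_fps :: "complex fps" where
  "log_fps = Abs_fps (\<lambda>n. - of_real (modulus_coeff n) / of_nat n)"

lemma fps_conv_radius_ge_1:
  fixes f :: "complex fps"
  assumes "\<And>n. cmod (fps_nth f n) \<le> 1"
  shows "fps_conv_radius f \<ge> 1"
  unfolding fps_conv_radius_def
proof (rule conv_radius_geI_ex)
  fix r :: real assume r: "0 < r" "ereal r < 1"
  have "summable (\<lambda>n. fps_nth f n * of_real r ^ n)"
  proof (rule summable_comparison_test'[of "\<lambda>n. r ^ n" 0])
    show "norm (fps_nth f n * of_real r ^ n) \<le> r ^ n" for n
      using assms[of n] r by (simp add: norm_mult norm_power mult_left_le_one_le)
  qed (use r in \<open>simp add: summable_geometric\<close>)
  then show "\<exists>z. norm z = r \<and> summable (\<lambda>n. fps_nth f n * z ^ n)"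
    using r by (intro exI[of _ "of_real r"]) auto
qed

lemma conv_radius_hyp_fps: "fps_conv_radius hyp_fps \<ge> 1"
  using modulus_coeff_bounds by (intro fps_conv_radius_ge_1) (auto simp: hyp_fps_def)

lemma conv_radius_log_fps: "fps_conv_radius log_fps \<ge> 1"
proof (rule fps_conv_radius_ge_1)
  fix n show "cmod (fps_nth log_fps n) \<le> 1"
    using modulus_coeff_bounds[of n]
    by (cases "n = 0") (auto simp: log_fps_def norm_divide divide_le_eq intro: order_trans)
qed

lemma norm_less_conv_radius:
  assumes "cmod z < 1" "fps_conv_radius f \<ge> 1"
  shows "ereal (cmod z) < fps_conv_radius f"
  using assms by (metis ereal_less(3) less_ereal.simps(1) one_ereal_def order_less_le_trans)

lemma conv_radius_deriv_hyp_fps: "fps_conv_radius (fps_deriv hyp_fps) \<ge> 1"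
  using conv_radius_hyp_fps fps_conv_radius_deriv order_trans by blast

definition hyp :: "complex \<Rightarrow> complex" where "hyp = eval_fps hyp_fps"
definition hyp' :: "complex \<Rightarrow> complex" where "hyp' = eval_fps (fps_deriv hyp_fps)"
definition log_mean :: "complex \<Rightarrow> complex" where "log_mean = eval_fps log_fps"

lemma hyp_0 [simp]: "hyp 0 = 1"
  by (simp add: hyp_def eval_fps_at_0 hyp_fps_def)

lemma log_mean_0 [simp]: "log_mean 0 = 0"
  by (simp add: log_mean_def eval_fps_at_0 log_fps_def)

lemma log_mean_altdef:
  "log_mean z = (\<Sum>n. - of_real (modulus_coeff n) * z ^ n / of_nat n)"
  by (simp add: log_mean_def eval_fps_def log_fps_def)

lemma has_field_derivative_hyp:
  "cmod z < 1 \<Longrightarrow> (hyp has_field_derivative hyp' z) (at z within A)"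
  unfolding hyp_def hyp'_def
  by (intro has_field_derivative_eval_fps norm_less_conv_radius conv_radius_hyp_fps)

text \<open>Self-adjoint form of the hypergeometric equation: with the flux
  \<open>z * (1 - z) * hyp' z\<close> as second unknown, the Wronskian argument never meets a second
  derivative.\<close>

lemma hyp_ode:
  assumes z: "cmod z < 1"
  shows "((\<lambda>z. z * (1 - z) * hyp' z) has_field_derivative hyp z / 4) (at z)"
proof -
  define D where "D = fps_deriv hyp_fps"
  define E where "E = fps_X * ((1 - fps_X) * D)"
  have rD: "fps_conv_radius D \<ge> 1"
    unfolding D_def by (rule conv_radius_deriv_hyp_fps)
  have r1: "fps_conv_radius (1 - fps_X :: complex fps) = \<infinity>"
    by (metis fps_conv_radius_1 fps_conv_radius_diff fps_conv_radius_fps_X min.idem top.extremum_unique top_ereal_def)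
  have rXD: "fps_conv_radius ((1 - fps_X) * D) \<ge> 1"
    using fps_conv_radius_mult[of "1 - fps_X" D] rD r1 by (auto intro: order_trans)
  have rE: "fps_conv_radius E \<ge> 1"
    unfolding E_def using fps_conv_radius_mult[of fps_X "(1 - fps_X) * D"] rXD by (auto intro: order_trans)
  have eval: "eval_fps E w = w * (1 - w) * hyp' w" if "cmod w < 1" for w
  proof -
    have "eval_fps E w = eval_fps fps_X w * (eval_fps (1 - fps_X) w * eval_fps D w)"
      unfolding E_def using norm_less_conv_radius[OF that rD] norm_less_conv_radius[OF that rXD] r1
      by (simp add: eval_fps_mult)
    also have "eval_fps (1 - fps_X) w = 1 - w"
      by (subst eval_fps_diff) auto
    finally show ?thesis by (simp add: hyp'_def D_def)
  qed
  have "fps_deriv E = fps_const (1 / 4) * hyp_fps"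
  proof (rule fps_ext)
    fix n
    have c: "fps_nth D n = of_nat (n + 1) * of_real (modulus_coeff (n + 1))" for n
      by (simp add: D_def hyp_fps_def)
    have "E = fps_X * D - fps_X * (fps_X * D)"
      by (simp add: E_def algebra_simps)
    then have "fps_nth E (n + 1) = fps_nth D n - (if n = 0 then 0 else fps_nth D (n - 1))"
      by simp
    also have "\<dots> = of_nat (n + 1) * of_real (modulus_coeff (n + 1)) - of_nat n * of_real (modulus_coeff n)"
      by (cases n) (auto simp: c)
    finally have "fps_nth (fps_deriv E) n = of_nat (n + 1) *
        (of_nat (n + 1) * of_real (modulus_coeff (n + 1)) - of_nat n * of_real (modulus_coeff n))"
      by simp
    also have "\<dots> = of_real ((real n + 1)\<^sup>2 * modulus_coeff (Suc n) - (real n + 1) * real n * modulus_coeff n)"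
      by (simp add: algebra_simps power2_eq_square)
    also have "\<dots> = of_real (modulus_coeff n / 4)"
      unfolding modulus_coeff_rec by (simp add: algebra_simps power2_eq_square)
    finally show "fps_nth (fps_deriv E) n = fps_nth (fps_const (1 / 4) * hyp_fps) n"
      by (simp add: hyp_fps_def)
  qed
  then have ev: "eval_fps (fps_deriv E) z = hyp z / 4"
    using norm_less_conv_radius[OF z conv_radius_hyp_fps] by (simp add: eval_fps_mult hyp_def)
  have "(eval_fps E has_field_derivative hyp z / 4) (at z)"
    using has_field_derivative_eval_fps[OF norm_less_conv_radius[OF z rE], of UNIV] unfolding ev .
  moreover have "eventually (\<lambda>w. w \<in> ball 0 1) (nhds z)"
    using z by (intro eventually_nhds_in_open) auto
  then have "eventually (\<lambda>w. eval_fps E w = w * (1 - w) * hyp' w) (nhds z)"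
    by (rule eventually_mono) (auto intro: eval)
  ultimately show ?thesis
    by (subst (asm) DERIV_cong_ev[OF refl _ refl])
qed

definition log_mean' :: "complex \<Rightarrow> complex" where "log_mean' = eval_fps (fps_deriv log_fps)"

lemma has_field_derivative_log_mean:
  "cmod z < 1 \<Longrightarrow> (log_mean has_field_derivative log_mean' z) (at z within A)"
  unfolding log_mean_def log_mean'_def
  by (intro has_field_derivative_eval_fps norm_less_conv_radius conv_radius_log_fps)

lemma log_mean'_hyp:
  assumes z: "cmod z < 1"
  shows "z * log_mean' z = 1 - hyp z"
proof -
  have r: "fps_conv_radius (fps_deriv log_fps) \<ge> 1"
    using conv_radius_log_fps fps_conv_radius_deriv order_trans by blast
  have "fps_X * fps_deriv log_fps = 1 - hyp_fps"
  proof (rule fps_ext)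
    show "fps_nth (fps_X * fps_deriv log_fps) n = fps_nth (1 - hyp_fps) n" for n
      by (cases n) (auto simp: log_fps_def hyp_fps_def simp del: of_nat_Suc)
  qed
  then have "eval_fps (fps_X * fps_deriv log_fps) z = eval_fps (1 - hyp_fps) z" by simp
  also have "eval_fps (fps_X * fps_deriv log_fps) z = z * log_mean' z"
    using norm_less_conv_radius[OF z r] by (simp add: eval_fps_mult log_mean'_def)
  also have "eval_fps (1 - hyp_fps) z = 1 - hyp z"
    using norm_less_conv_radius[OF z conv_radius_hyp_fps] by (simp add: eval_fps_diff hyp_def)
  finally show ?thesis .
qed

section \<open>Logarithmic integrals over the torus and the function \<open>mu\<close>\<close>

lemma integral_ln_cos_prod:
  fixes z :: complex
  assumes z: "cmod z < 1"
  defines "a \<equiv> \<lambda>t. (cos (2 * pi * fst t))\<^sup>2 * (cos (2 * pi * snd t))\<^sup>2"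
  shows "set_integrable lborel unit_square (\<lambda>t. ln (cmod (1 - z * of_real (a t))))"
    and "(LINT t:unit_square|lborel. ln (cmod (1 - z * of_real (a t)))) = Re (log_mean z)"
proof -
  have cont: "continuous_on unit_square a" unfolding a_def by (intro continuous_intros)
  have bound: "\<bar>a t\<bar> \<le> 1" for t
    unfolding a_def by (simp add: abs_mult abs_square_le_1 mult_le_one)
  show "set_integrable lborel unit_square (\<lambda>t. ln (cmod (1 - z * of_real (a t))))"
    by (rule integral_ln_one_minus(1)[OF cont bound z])
  show "(LINT t:unit_square|lborel. ln (cmod (1 - z * of_real (a t)))) = Re (log_mean z)"
    unfolding integral_ln_one_minus(2)[OF cont bound z] log_mean_altdef
    by (simp add: a_def moment_cos_prod)
qed

lemma abs_minus_mean_le_1: "\<bar>x\<bar> \<le> 1 \<Longrightarrow> \<bar>y\<bar> \<le> 1 \<Longrightarrow> \<bar>- (x + y) / 2\<bar> \<le> (1 :: real)"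
  by (auto simp: abs_le_iff field_simps)

text \<open>The sign of X fits the factorisation 4/w + x + 1/x + y + 1/y = (4/w) (1 - w X) on the
  torus. The odd moments of X vanish and the even ones are \<open>modulus_coeff\<close>, so the
  series is one in w^2; the factor 1/2 comes from the denominators 2k.\<close>

lemma integral_ln_cos_sum:
  fixes w :: complex
  assumes w: "cmod w < 1"
  defines "X \<equiv> \<lambda>t. - (cos (2 * pi * fst t) + cos (2 * pi * snd t)) / 2"
  shows "set_integrable lborel unit_square (\<lambda>t. ln (cmod (1 - w * of_real (X t))))"
    and "(LINT t:unit_square|lborel. ln (cmod (1 - w * of_real (X t)))) = Re (log_mean (w\<^sup>2)) / 2"
proof -
  have cont: "continuous_on unit_square X" unfolding X_def by (intro continuous_intros) auto
  have bound: "\<bar>X t\<bar> \<le> 1" for t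
    unfolding X_def by (intro abs_minus_mean_le_1 abs_cos_le_one)
  show "set_integrable lborel unit_square (\<lambda>t. ln (cmod (1 - w * of_real (X t))))"
    by (rule integral_ln_one_minus(1)[OF cont bound w])
  define m where "m = (\<lambda>n. LINT t:unit_square|lborel. X t ^ n)"
  have m: "m n = (-1/2) ^ n * (LINT t:unit_square|lborel. (cos (2 * pi * fst t) + cos (2 * pi * snd t)) ^ n)" for n
  proof -
    have "X t ^ n = (-1/2) ^ n * (cos (2 * pi * fst t) + cos (2 * pi * snd t)) ^ n" for t
    proof -
      have "X t = (-1/2) * (cos (2 * pi * fst t) + cos (2 * pi * snd t))" by (simp add: X_def field_simps)
      then show ?thesis by (simp only: power_mult_distrib)
    qed
    then show ?thesis unfolding m_def by simp
  qed
  have odd: "m n = 0" if "n \<notin> range (\<lambda>k. 2 * k)" for n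
  proof -
    from that have "odd n" by (metis evenE rangeI)
    then obtain k where "n = 2 * k + 1" by (elim oddE)
    then show ?thesis by (simp only: m moment_cos_sum_odd mult_zero_right)
  qed
  have even: "m (2 * k) = modulus_coeff k" for k
    unfolding m moment_cos_sum_even by (simp add: power_mult power_divide)
  have "(\<Sum>n. - of_real (m n) * w ^ n / of_nat n) = (\<Sum>k. - of_real (m (2 * k)) * w ^ (2 * k) / of_nat (2 * k))"
    by (rule suminf_mono_reindex[symmetric]) (use odd in \<open>auto simp: strict_mono_def\<close>)
  also have "\<dots> = (\<Sum>k. (- of_real (modulus_coeff k) * (w\<^sup>2) ^ k / of_nat k) / 2)"
    by (simp only: even power_mult of_nat_mult of_nat_numeral) (simp add: mult.commute)
  also have "\<dots> = log_mean (w\<^sup>2) / 2"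
  proof -
    have w2: "cmod (w\<^sup>2) < 1" using w by (simp add: norm_power power_less_one_iff abs_square_less_1)
    have "summable (\<lambda>n. - of_real (modulus_coeff n) * (w\<^sup>2) ^ n / of_nat n)"
      using summable_fps[OF norm_less_conv_radius[OF w2 conv_radius_log_fps]] by (simp add: log_fps_def)
    then show ?thesis unfolding log_mean_altdef by (rule suminf_divide)
  qed
  finally have S: "(\<Sum>n. - of_real (m n) * w ^ n / of_nat n) = log_mean (w\<^sup>2) / 2" .
  show "(LINT t:unit_square|lborel. ln (cmod (1 - w * of_real (X t)))) = Re (log_mean (w\<^sup>2)) / 2"
    unfolding integral_ln_one_minus(2)[OF cont bound w] S[unfolded m_def] by simp
qed

lemma set_integral_unit_square_const: "(LINT t:unit_square|lborel. c) = (c :: real)"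
  using set_integral_unit_square_mult[of "\<lambda>_. c" "\<lambda>_. 1"] by (simp add: set_lebesgue_integral_def)

text \<open>Taking out the factor \<open>4 / csqrt t\<close> leaves the integral of
  \<open>integral_ln_cos_sum\<close>, whose value depends on \<open>csqrt t\<close> through its
  square alone.\<close>

lemma mu_eq:
  assumes t: "t \<noteq> 0" "cmod t < 1"
  shows "mu t = ln 4 - ln (cmod t) / 2 + Re (log_mean t) / 2"
proof -
  define w where "w = csqrt t"
  have w: "cmod w < 1" "w \<noteq> 0" "w\<^sup>2 = t"
    using t by (auto simp: w_def)
  define X where "X = (\<lambda>t. - (cos (2 * pi * fst t) + cos (2 * pi * snd t)) / 2)"
  have nz: "1 - w * of_real (X s) \<noteq> 0" for s
  proof -
    have "\<bar>X s\<bar> \<le> 1"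
      unfolding X_def by (intro abs_minus_mean_le_1 abs_cos_le_one)
    then have "cmod (w * of_real (X s)) \<le> cmod w * 1"
      unfolding norm_mult by (intro mult_left_mono) auto
    with w show ?thesis by force
  qed
  have cis2: "cis x + inverse (cis x) = of_real (2 * cos x)" for x
    by (simp add: complex_eq_iff)
  have "4 / w + cis x + inverse (cis x) + cis y + inverse (cis y) =
        4 / w * (1 - w * of_real (- (cos x + cos y) / 2))" for x y
  proof -
    have "4 / w + cis x + inverse (cis x) + cis y + inverse (cis y) =
          4 / w + (cis x + inverse (cis x)) + (cis y + inverse (cis y))" by simp
    also have "\<dots> = 4 / w * (1 - w * of_real (- (cos x + cos y) / 2))"
      unfolding cis2 using w by (simp add: field_simps)
    finally show ?thesis .
  qed
  note factor = this
  have eq: "ln (cmod (4 / w + cis (2 * pi * fst s) + inverse (cis (2 * pi * fst s)) + cis (2 * pi * snd s)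
         + inverse (cis (2 * pi * snd s)))) = ln (cmod (4 / w)) + ln (cmod (1 - w * of_real (X s)))" for s
  proof -
    have "cmod (4 / w) > 0" "cmod (1 - w * of_real (X s)) > 0"
      using nz[of s] w(2) by (simp_all only: zero_less_norm_iff) simp_all
    then show ?thesis
      unfolding factor X_def norm_mult by (rule ln_mult_pos)
  qed
  have "mu t = (LINT s:unit_square|lborel. ln (cmod (4 / w)) + ln (cmod (1 - w * of_real (X s))))"
    unfolding mu_def mahler2_def w_def[symmetric] eq ..
  also have "\<dots> = ln (cmod (4 / w)) + Re (log_mean t) / 2"
    using integral_ln_cos_sum[OF w(1)] w(3) unfolding X_def
    by (subst set_integral_add) (auto simp: set_integral_unit_square_const intro!: set_integrable_unit_square)
  also have "cmod (4 / w) = 4 / sqrt (cmod t)"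
    by (simp add: norm_divide w_def norm_csqrt)
  also have "ln (4 / sqrt (cmod t)) = ln 4 - ln (cmod t) / 2"
    using t by (simp add: ln_div ln_sqrt)
  finally show ?thesis .
qed

subsection \<open>The cubic transformation\<close>

text \<open>
  The rational functions \<open>cubic_mod\<close> and \<open>cubic_comod\<close> are Ramanujan's uniformisation of the
  degree-3 modular equation: they parametrise the curve \<open>G3 \<alpha> \<beta> = 0\<close>.
\<close>
definition cubic_mod :: "complex \<Rightarrow> complex" where
  "cubic_mod p = p * (2 + p) ^ 3 / (1 + 2 * p) ^ 3"

definition cubic_comod :: "complex \<Rightarrow> complex" where
  "cubic_comod p = p ^ 3 * (2 + p) / (1 + 2 * p)"

lemma has_field_derivative_cubic_mod:
  assumes "1 + 2 * p \<noteq> 0"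
  shows "(cubic_mod has_field_derivative 2 * (2 + p)\<^sup>2 * (1 - p)\<^sup>2 / (1 + 2 * p) ^ 4) (at p within A)"
proof -
  have "((\<lambda>p. p * (2 + p) ^ 3 / (1 + 2 * p) ^ 3) has_field_derivative
      ((((2 + p) ^ 3 + p * (3 * (2 + p)\<^sup>2)) * (1 + 2 * p) ^ 3 - p * (2 + p) ^ 3 * (3 * (1 + 2 * p)\<^sup>2 * 2)) /
        ((1 + 2 * p) ^ 3 * (1 + 2 * p) ^ 3))) (at p within A)"
    using assms by (auto intro!: derivative_eq_intros simp: algebra_simps)
  also have "((((2 + p) ^ 3 + p * (3 * (2 + p)\<^sup>2)) * (1 + 2 * p) ^ 3 - p * (2 + p) ^ 3 * (3 * (1 + 2 * p)\<^sup>2 * 2)) /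
        ((1 + 2 * p) ^ 3 * (1 + 2 * p) ^ 3)) = 2 * (2 + p)\<^sup>2 * (1 - p)\<^sup>2 / (1 + 2 * p) ^ 4"
    using assms by (simp add: frac_eq_eq) algebra
  finally show ?thesis by (simp add: cubic_mod_def[abs_def])
qed

lemma has_field_derivative_cubic_comod:
  assumes "1 + 2 * p \<noteq> 0"
  shows "(cubic_comod has_field_derivative 6 * p\<^sup>2 * (1 + p)\<^sup>2 / (1 + 2 * p)\<^sup>2) (at p within A)"
proof -
  have "((\<lambda>p. p ^ 3 * (2 + p) / (1 + 2 * p)) has_field_derivative
      (((3 * p\<^sup>2 * (2 + p) + p ^ 3) * (1 + 2 * p) - p ^ 3 * (2 + p) * 2) /
        ((1 + 2 * p) * (1 + 2 * p)))) (at p within A)"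
    using assms by (auto intro!: derivative_eq_intros simp: algebra_simps)
  also have "(((3 * p\<^sup>2 * (2 + p) + p ^ 3) * (1 + 2 * p) - p ^ 3 * (2 + p) * 2) /
        ((1 + 2 * p) * (1 + 2 * p))) = 6 * p\<^sup>2 * (1 + p)\<^sup>2 / (1 + 2 * p)\<^sup>2"
    using assms by (simp add: frac_eq_eq) algebra
  finally show ?thesis by (simp add: cubic_comod_def[abs_def])
qed

text \<open>The complement factors because of the involution p -> (1 - p) / (1 + 2p): it carries
  \<open>cubic_comod\<close> to \<open>1 - cubic_mod\<close>, and \<open>cubic_mod\<close> to
  \<open>1 - cubic_comod\<close>.\<close>

lemma one_minus_cubic_mod:
  "1 + 2 * p \<noteq> 0 \<Longrightarrow> 1 - cubic_mod p = (1 - p) ^ 3 * (1 + p) / (1 + 2 * p) ^ 3"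
  by (simp add: cubic_mod_def field_simps) algebra

lemma one_minus_cubic_comod:
  "1 + 2 * p \<noteq> 0 \<Longrightarrow> 1 - cubic_comod p = (1 + p) ^ 3 * (1 - p) / (1 + 2 * p)"
  by (simp add: cubic_comod_def field_simps) algebra

lemma G3_cubic:
  "1 + 2 * p \<noteq> 0 \<Longrightarrow> G3 (cubic_mod p) (cubic_comod p) = 0"
proof -
  assume nz: "1 + 2 * p \<noteq> 0"
  define d where "d = 1 + 2 * p"
  define e where "e = 2 + p"
  \<comment> \<open>Once the inverse is a variable bound by \<open>i * d = 1\<close>, the claim is a
    polynomial consequence of that equation and within reach of \<open>algebra\<close>. The same
    device recurs below.\<close>
  define i where "i = inverse d"
  have i: "i * d = 1" using nz by (simp add: i_def d_def)
  have "cubic_mod p = p * e ^ 3 * i ^ 3" "cubic_comod p = p ^ 3 * e * i"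
    by (simp_all add: cubic_mod_def cubic_comod_def d_def e_def i_def field_simps)
  moreover have "G3 (p * e ^ 3 * i ^ 3) (p ^ 3 * e * i) = 0"
    using i unfolding G3_def d_def e_def by algebra
  ultimately show ?thesis by simp
qed

lemma small_nonzero:
  fixes p :: complex
  assumes "cmod p < 1 / 20"
  shows "1 + 2 * p \<noteq> 0" "2 + p \<noteq> 0" "1 + p \<noteq> 0" "1 - p \<noteq> 0"
proof -
  have *: "1 + x \<noteq> 0" if "cmod x < 1" for x
  proof
    assume "1 + x = 0"
    then have "x = -1" by (metis add_eq_0_iff)
    with that show False by simp
  qed
  show "1 + 2 * p \<noteq> 0" "1 + p \<noteq> 0" "1 - p \<noteq> 0"
    using *[of "2 * p"] *[of p] *[of "-p"] assms by (auto simp: norm_mult)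
  show "2 + p \<noteq> 0"
  proof
    assume "2 + p = 0"
    then have "p = -2" by (metis add_eq_0_iff)
    with assms show False by simp
  qed
qed

text \<open>The radius 1/20 is a convenient choice: (1/20) 2.1^3 is about 0.463, below 0.9^3 =
  0.729.\<close>

lemma norm_cubic_less_1:
  assumes "cmod p < 1 / 20"
  shows "cmod (cubic_mod p) < 1" "cmod (cubic_comod p) < 1"
proof -
  have n: "cmod (2 + p) \<le> 21 / 10" "cmod (1 + 2 * p) \<ge> 9 / 10"
    using norm_triangle_ineq[of 2 p] norm_diff_ineq[of 1 "2 * p"] assms by (auto simp: norm_mult)
  have pos: "cmod (1 + 2 * p) > 0" using n by linarith
  have 1: "cmod p * cmod (2 + p) ^ 3 \<le> (1 / 20) * (21 / 10) ^ 3"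
    using assms n by (intro mult_mono power_mono) auto
  have 2: "(9 / 10) ^ 3 \<le> cmod (1 + 2 * p) ^ 3"
    using n by (intro power_mono) auto
  have "cmod p * cmod (2 + p) ^ 3 < cmod (1 + 2 * p) ^ 3"
    using 1 2 by (simp add: power3_eq_cube)
  then show "cmod (cubic_mod p) < 1"
    using pos by (simp add: cubic_mod_def norm_divide norm_mult norm_power)
  have 3: "cmod p ^ 3 * cmod (2 + p) \<le> (1 / 20) ^ 3 * (21 / 10)"
    using assms n by (intro mult_mono power_mono) auto
  have "cmod p ^ 3 * cmod (2 + p) < cmod (1 + 2 * p)"
    using 3 n by (simp add: power3_eq_cube)
  then show "cmod (cubic_comod p) < 1"
    using pos by (simp add: cubic_comod_def norm_divide norm_mult norm_power)
qed

lemma cubic_0 [simp]: "cubic_mod 0 = 0" "cubic_comod 0 = 0"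
  by (simp_all add: cubic_mod_def cubic_comod_def)

text \<open>The first two identities measure both moduli against the same derivation N d/dp. The
  third is what remains, after they are used, of the demand that
  \<open>(1 + 2 * p) * hyp (cubic_comod p)\<close> solve the equation of
  \<open>hyp (cubic_mod p)\<close> written in the variable p.\<close>

lemma wronskian_identities:
  fixes p :: complex
  assumes nz: "1 + 2 * p \<noteq> 0"
  defines "U \<equiv> cubic_mod p" and "T \<equiv> cubic_comod p"
    and "U' \<equiv> 2 * (2 + p)\<^sup>2 * (1 - p)\<^sup>2 / (1 + 2 * p) ^ 4"
    and "T' \<equiv> 6 * p\<^sup>2 * (1 + p)\<^sup>2 / (1 + 2 * p)\<^sup>2"
    and "N \<equiv> p * (2 + p) * (1 - p\<^sup>2)"
  shows "N * U' = 2 * (1 + 2 * p)\<^sup>2 * (U * (1 - U))"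
    and "N * T' = 6 * (T * (1 - T))"
    and "2 * (2 + 2 * p - 6 * p\<^sup>2 - 4 * p ^ 3) * (1 + 2 * p) - 8 * N + 3 / 2 * T' * (1 + 2 * p)\<^sup>2
           - (1 + 2 * p) ^ 4 * U' / 2 = 0"
proof -
  show "N * U' = 2 * (1 + 2 * p)\<^sup>2 * (U * (1 - U))"
    unfolding U_def one_minus_cubic_mod[OF nz] unfolding N_def U'_def cubic_mod_def
    using nz by (simp add: divide_simps) algebra
  show "N * T' = 6 * (T * (1 - T))"
    unfolding T_def one_minus_cubic_comod[OF nz] unfolding N_def T'_def cubic_comod_def
    using nz by (simp add: divide_simps) algebra
  show "2 * (2 + 2 * p - 6 * p\<^sup>2 - 4 * p ^ 3) * (1 + 2 * p) - 8 * N + 3 / 2 * T' * (1 + 2 * p)\<^sup>2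
           - (1 + 2 * p) ^ 4 * U' / 2 = 0"
    unfolding N_def T'_def U'_def
    using nz by (simp add: divide_simps) algebra
qed

text \<open>
  Both sides of the cubic transformation solve the same second-order equation with a logarithmic
  singularity at 0. The quantity \<open>D\<close> below is their Wronskian times the factor that makes it
  constant; that factor vanishes at 0, hence so does the Wronskian everywhere.
\<close>
lemma wronskian_zero:
  fixes p :: complex
  assumes p: "cmod p < 1 / 20"
  defines "U \<equiv> cubic_mod p" and "T \<equiv> cubic_comod p"
  shows "hyp U * (2 * (p * (2 + p) * (1 - p\<^sup>2)) * hyp T / (1 + 2 * p)\<^sup>2
            + 6 * (T * (1 - T) * hyp' T) / (1 + 2 * p))
          = 2 * (1 + 2 * p) * (U * (1 - U) * hyp' U) * hyp T"
proof -
  define h where "h = (\<lambda>z. z * (1 - z) * hyp' z)"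
  define N :: "complex \<Rightarrow> complex" where "N = (\<lambda>p. p * (2 + p) * (1 - p\<^sup>2))"
  define D where "D = (\<lambda>p. hyp (cubic_mod p) * (2 * N p * hyp (cubic_comod p) / (1 + 2 * p)\<^sup>2
      + 6 * h (cubic_comod p) / (1 + 2 * p)) - 2 * (1 + 2 * p) * h (cubic_mod p) * hyp (cubic_comod p))"
  have deriv: "(D has_field_derivative 0) (at p)" if p: "cmod p < 1 / 20" for p
  proof -
    define U where "U = cubic_mod p"
    define T where "T = cubic_comod p"
    define U' where "U' = 2 * (2 + p)\<^sup>2 * (1 - p)\<^sup>2 / (1 + 2 * p) ^ 4"
    define T' where "T' = 6 * p\<^sup>2 * (1 + p)\<^sup>2 / (1 + 2 * p)\<^sup>2"
    define N' where "N' = 2 + 2 * p - 6 * p\<^sup>2 - 4 * p ^ 3"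
    define d where "d = 1 + 2 * p"
    have nz: "d \<noteq> 0" using small_nonzero[OF p] by (simp add: d_def)
    have dU: "(cubic_mod has_field_derivative U') (at p)" and dT: "(cubic_comod has_field_derivative T') (at p)"
      unfolding U'_def T'_def using small_nonzero[OF p]
      by (intro has_field_derivative_cubic_mod has_field_derivative_cubic_comod; simp)+
    have lt: "cmod U < 1" "cmod T < 1" unfolding U_def T_def using norm_cubic_less_1[OF p] .
    have y1: "((\<lambda>p. hyp (cubic_mod p)) has_field_derivative hyp' U * U') (at p)"
      unfolding U_def by (rule DERIV_chain2[OF has_field_derivative_hyp dU]) (use lt in \<open>simp add: U_def\<close>)
    have f2: "((\<lambda>p. hyp (cubic_comod p)) has_field_derivative hyp' T * T') (at p)"
      unfolding T_def by (rule DERIV_chain2[OF has_field_derivative_hyp dT]) (use lt in \<open>simp add: T_def\<close>)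
    have h1: "((\<lambda>p. h (cubic_mod p)) has_field_derivative hyp U / 4 * U') (at p)"
      unfolding U_def h_def by (rule DERIV_chain2[OF hyp_ode dU]) (use lt in \<open>simp add: U_def\<close>)
    have h2: "((\<lambda>p. h (cubic_comod p)) has_field_derivative hyp T / 4 * T') (at p)"
      unfolding T_def h_def by (rule DERIV_chain2[OF hyp_ode dT]) (use lt in \<open>simp add: T_def\<close>)
    have dN: "(N has_field_derivative N') (at p)"
      unfolding N_def N'_def
      by (rule derivative_eq_intros refl | simp)+ (simp add: algebra_simps power2_eq_square power3_eq_cube)
    have dd: "((\<lambda>p. 1 + 2 * p) has_field_derivative 2) (at p)"
      by (auto intro!: derivative_eq_intros)
    have dd2: "((\<lambda>p. (1 + 2 * p)\<^sup>2) has_field_derivative 4 * d) (at p)"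
      by (auto intro!: derivative_eq_intros simp: d_def)
    define a where "a = 2 * N p * hyp T / d\<^sup>2 + 6 * h T / d"
    have A: "((\<lambda>p. 2 * N p * hyp (cubic_comod p) / (1 + 2 * p)\<^sup>2 + 6 * h (cubic_comod p) / (1 + 2 * p))
        has_field_derivative
        ((2 * N' * hyp T + 2 * N p * (hyp' T * T')) * d\<^sup>2 - 2 * N p * hyp T * (4 * d)) / (d\<^sup>2 * d\<^sup>2)
        + (6 * (hyp T / 4 * T') * d - 6 * h T * 2) / (d * d)) (at p)" (is "(_ has_field_derivative ?A) _")
      by (rule derivative_eq_intros dN f2 h2 dd dd2 refl | use nz in \<open>simp add: d_def T_def\<close>)+
    have B: "((\<lambda>p. 2 * (1 + 2 * p) * h (cubic_mod p) * hyp (cubic_comod p)) has_field_derivative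
        (4 * h U + 2 * d * (hyp U / 4 * U')) * hyp T + 2 * d * h U * (hyp' T * T')) (at p)"
      (is "(_ has_field_derivative ?B) _")
      by (rule derivative_eq_intros dd h1 f2 refl | simp add: d_def T_def U_def algebra_simps)+
    have "(D has_field_derivative hyp' U * U' * a + ?A * hyp U - ?B) (at p)"
      unfolding D_def
      by (intro DERIV_diff B DERIV_cong[OF DERIV_mult[OF y1 A]]) (simp add: a_def U_def T_def d_def)
    moreover have "hyp' U * U' * a + ?A * hyp U - ?B = 0"
    proof -
      have e1: "N p * U' = 2 * d\<^sup>2 * (U * (1 - U))" and e2: "N p * T' = 6 * (T * (1 - T))"
        and e3: "2 * N' * d - 8 * N p + 3 / 2 * T' * d\<^sup>2 - d ^ 4 * U' / 2 = 0"
        using wronskian_identities[of p] nz by (simp_all add: U_def T_def U'_def T'_def N_def N'_def d_def)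
      \<comment> \<open>Eliminating N between \<open>e1\<close> and \<open>e2\<close> proves this
        only after multiplication by N, whose sole zero in the disc is p = 0; there both moduli
        vanish.\<close>
      have e4: "3 * U' * (T * (1 - T)) = d\<^sup>2 * (U * (1 - U)) * T'"
      proof (cases "N p = 0")
        case True
        then have "p = 0"
          using small_nonzero[OF p] by (auto simp: N_def power2_eq_1_iff add_eq_0_iff)
        then show ?thesis by (simp add: T_def U_def)
      next
        case False
        have "N p * (3 * U' * (T * (1 - T))) = N p * (d\<^sup>2 * (U * (1 - U)) * T')"
          using e1 e2 by algebra
        then show ?thesis using False by simp
      qed
      \<comment> \<open>Sort by products: the coefficient of \<open>hyp' U * hyp' T\<close> vanishes
        by \<open>e4\<close>, that of \<open>hyp' U * hyp T\<close> by \<open>e1\<close>, that of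
        \<open>hyp U * hyp' T\<close> by \<open>e2\<close>, and that of \<open>hyp U * hyp T\<close>
        by \<open>e3\<close> and \<open>e2\<close>-free terms alone.\<close>
      have "d ^ 3 * (hyp' U * U' * a + ?A * hyp U - ?B) =
         hyp' U * U' * (2 * N p * hyp T * d + 6 * h T * d\<^sup>2)
         + (2 * N' * hyp T * d + 2 * N p * hyp' T * T' * d - 8 * N p * hyp T + 3 / 2 * hyp T * T' * d\<^sup>2 - 12 * h T * d) * hyp U
         - (4 * h U + d * hyp U * U' / 2) * hyp T * d ^ 3 - 2 * d ^ 4 * h U * hyp' T * T'"
        using nz by (simp add: a_def field_simps power2_eq_square power3_eq_cube power4_eq_xxxx)
      also have "\<dots> = 0"
        unfolding h_def using e1 e2 e3 e4 by algebra
      finally show ?thesis using nz by simp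
    qed
    ultimately show ?thesis by simp
  qed
  have "\<exists>c. \<forall>x\<in>ball 0 (1 / 20). D x = c"
    by (rule has_field_derivative_zero_constant)
       (auto intro!: has_field_derivative_at_within deriv)
  then have "D p = D 0" using p by force
  also have "\<dots> = 0" by (simp add: D_def N_def h_def)
  finally show ?thesis by (simp add: D_def N_def h_def U_def T_def)
qed

text \<open>A vanishing Wronskian means that the quotient of the two solutions has derivative 0.
  This is obtained after division by N, hence only for p different from 0; continuity bridges that
  point, where the quotient is 1. The radius is shrunk until the denominator has no zero.\<close>

lemma hyp_cubic_transformation:
  obtains r where "0 < r" "r \<le> 1 / 20"
    "\<And>p. cmod p < r \<Longrightarrow> hyp (cubic_mod p) = (1 + 2 * p) * hyp (cubic_comod p)"
proof -
  define y where "y = (\<lambda>p. (1 + 2 * p) * hyp (cubic_comod p))"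
  have dy: "(y has_field_derivative (2 * hyp (cubic_comod p) + (1 + 2 * p) *
      (hyp' (cubic_comod p) * (6 * p\<^sup>2 * (1 + p)\<^sup>2 / (1 + 2 * p)\<^sup>2)))) (at p)" if "cmod p < 1 / 20" for p
  proof -
    have f2: "((\<lambda>p. hyp (cubic_comod p)) has_field_derivative
        hyp' (cubic_comod p) * (6 * p\<^sup>2 * (1 + p)\<^sup>2 / (1 + 2 * p)\<^sup>2)) (at p)"
      by (intro DERIV_chain2[OF has_field_derivative_hyp] has_field_derivative_cubic_comod
            small_nonzero norm_cubic_less_1 that)
    show ?thesis unfolding y_def
      by (rule derivative_eq_intros f2 refl | simp)+
  qed
  have "isCont y 0" using dy[of 0] DERIV_isCont by auto
  moreover have "y 0 \<noteq> 0" by (simp add: y_def)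
  ultimately obtain e where e: "e > 0" "\<And>p. dist p 0 < e \<Longrightarrow> y p \<noteq> 0"
    using continuous_at_avoid[of 0 y 0] by (metis dist_commute)
  define r where "r = min e (1 / 20)"
  have r: "r > 0" "r \<le> 1 / 20" using e by (auto simp: r_def)
  have deriv: "((\<lambda>p. hyp (cubic_mod p) / y p) has_field_derivative 0) (at p)" if p: "cmod p < r" "p \<noteq> 0" for p
  proof -
    have p': "cmod p < 1 / 20" and y0: "y p \<noteq> 0" using p r e(2)[of p] by (auto simp: r_def)
    define d where "d = 1 + 2 * p"
    define N where "N = p * (2 + p) * (1 - p\<^sup>2)"
    define U where "U = cubic_mod p"
    define T where "T = cubic_comod p"
    define U' where "U' = 2 * (2 + p)\<^sup>2 * (1 - p)\<^sup>2 / d ^ 4"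
    define T' where "T' = 6 * p\<^sup>2 * (1 + p)\<^sup>2 / d\<^sup>2"
    have nz: "d \<noteq> 0" "N \<noteq> 0" using small_nonzero[OF p'] p(2) 
      by (auto simp: d_def N_def power2_eq_1_iff add_eq_0_iff)
    have e1: "N * U' = 2 * d\<^sup>2 * (U * (1 - U))" and e2: "N * T' = 6 * (T * (1 - T))"
      using wronskian_identities[of p] nz by (simp_all add: U_def T_def U'_def T'_def N_def d_def)
    have "((\<lambda>p. hyp (cubic_mod p)) has_field_derivative hyp' U * U') (at p)"
      unfolding U_def U'_def d_def
      by (intro DERIV_chain2[OF has_field_derivative_hyp] has_field_derivative_cubic_mod
            small_nonzero norm_cubic_less_1 p')
    from DERIV_divide[OF this dy[OF p'] y0]
    have "((\<lambda>p. hyp (cubic_mod p) / y p) has_field_derivative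
        (hyp' U * U' * (d * hyp T) - hyp U * (2 * hyp T + d * (hyp' T * T'))) / (y p * y p)) (at p)"
      by (simp add: U_def T_def y_def d_def T'_def)
    also have "hyp' U * U' * (d * hyp T) - hyp U * (2 * hyp T + d * (hyp' T * T')) = 0"
    proof -
      have "hyp U * (2 * N * hyp T / d\<^sup>2 + 6 * (T * (1 - T) * hyp' T) / d)
          = 2 * d * (U * (1 - U) * hyp' U) * hyp T"
        using wronskian_zero[OF p'] by (simp add: U_def T_def N_def d_def)
      then have "hyp U * (2 * N * hyp T + 6 * (T * (1 - T) * hyp' T) * d)
          = 2 * d ^ 3 * (U * (1 - U) * hyp' U) * hyp T"
        using nz(1) by (simp add: field_simps power2_eq_square power3_eq_cube)
      then have "N * (hyp' U * U' * (d * hyp T) - hyp U * (2 * hyp T + d * (hyp' T * T'))) = 0"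
        using e1 e2 by algebra
      then show ?thesis using nz(2) by simp
    qed
    finally show ?thesis by simp
  qed
  have hd: "(hyp \<circ> cubic_mod) field_differentiable (at p)" if "cmod p < r" for p
  proof -
    have p': "cmod p < 1 / 20" using that r by simp
    have "((\<lambda>p. hyp (cubic_mod p)) has_field_derivative hyp' (cubic_mod p) * (2 * (2 + p)\<^sup>2 * (1 - p)\<^sup>2 / (1 + 2 * p) ^ 4)) (at p)"
      by (intro DERIV_chain2[OF has_field_derivative_hyp] has_field_derivative_cubic_mod
            small_nonzero norm_cubic_less_1 p')
    then show ?thesis unfolding field_differentiable_def comp_def by blast
  qed
  have "isCont (\<lambda>p. hyp (cubic_mod p) / y p) p" if "p \<in> ball 0 r" for p
    using that r e(2)[of p] dy[of p] hd[of p]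
    by (intro continuous_divide) (auto simp: r_def comp_def dest: DERIV_isCont field_differentiable_imp_continuous_at)
  then have "continuous_on (ball 0 r) (\<lambda>p. hyp (cubic_mod p) / y p)"
    by (intro continuous_at_imp_continuous_on) auto
  then obtain c where c: "\<And>p. p \<in> ball 0 r \<Longrightarrow> hyp (cubic_mod p) / y p = c"
    using DERIV_zero_connected_constant[of "ball 0 r" "{0}" "\<lambda>p. hyp (cubic_mod p) / y p"] deriv by auto
  have "c = 1" using c[of 0] r by (simp add: y_def)
  then have "hyp (cubic_mod p) = (1 + 2 * p) * hyp (cubic_comod p)" if "cmod p < r" for p
    using c[of p] e(2)[of p] that by (auto simp: y_def r_def field_simps)
  with r show ?thesis by (intro that)
qed

subsection \<open>The modular equation of degree 3\<close>

text \<open>Both inverse laws are needed: \<open>f (g w) = w\<close> to differentiate g implicitly,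
  and \<open>g (f z) = z\<close> to recover p from its modulus and to tell moduli of different
  parameters apart.\<close>

lemma holomorphic_local_inverse:
  fixes f :: "complex \<Rightarrow> complex"
  assumes hol: "f holomorphic_on S" and S: "open S" "0 \<in> S" and f0: "f 0 = 0" and df: "deriv f 0 \<noteq> 0"
  obtains g \<rho> \<delta> where "\<rho> > 0" "\<delta> > 0" "g holomorphic_on ball 0 \<rho>" "g 0 = 0"
    "\<And>w. cmod w < \<rho> \<Longrightarrow> g w \<in> S" "\<And>w. cmod w < \<rho> \<Longrightarrow> f (g w) = w"
    "\<And>z. cmod z < \<delta> \<Longrightarrow> g (f z) = z"
proof -
  obtain r where r: "r > 0" "ball 0 r \<subseteq> S" "inj_on f (ball 0 r)"
    using has_complex_derivative_locally_injective[OF hol S(2,1) df] by metis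
  have hol': "f holomorphic_on ball 0 r" using hol r(2) holomorphic_on_subset by blast
  obtain g where g: "g holomorphic_on (f ` ball 0 r)" "\<And>z. z \<in> ball 0 r \<Longrightarrow> g (f z) = z"
    using holomorphic_has_inverse[OF hol' open_ball r(3)] by metis
  have "open (f ` ball 0 r)" using hol' r(3) by (intro open_mapping_thm3) auto
  moreover have "0 \<in> f ` ball 0 r" using r(1) f0 by (intro image_eqI[of _ _ 0]) auto
  ultimately obtain \<rho> where \<rho>: "\<rho> > 0" "ball 0 \<rho> \<subseteq> f ` ball 0 r"
    by (meson openE)
  show thesis
  proof (rule that[OF \<rho>(1) r(1)])
    show "g holomorphic_on ball 0 \<rho>" using g(1) \<rho>(2) holomorphic_on_subset by blast
    show "g 0 = 0" using g(2)[of 0] r(1) f0 by simp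
    show "g w \<in> S" "f (g w) = w" if "cmod w < \<rho>" for w
    proof -
      have "w \<in> f ` ball 0 r" using that \<rho>(2) by auto
      then show "g w \<in> S" "f (g w) = w" using g(2) r(2) by auto
    qed
    show "g (f z) = z" if "cmod z < r" for z using g(2)[of z] that by simp
  qed
qed

text \<open>Subtract two equations and divide by the difference of the roots; doing this twice
  leaves the sum of the roots, and the other two relations follow by back substitution.\<close>

lemma vieta_cubic:
  fixes x y z :: "'a :: field"
  assumes "x ^ 3 + b * x\<^sup>2 + c * x + d = 0" "y ^ 3 + b * y\<^sup>2 + c * y + d = 0" "z ^ 3 + b * z\<^sup>2 + c * z + d = 0"
    and "x \<noteq> y" "x \<noteq> z" "y \<noteq> z"
  shows "x + y + z = - b" "x * y + x * z + y * z = c" "x * y * z = - d"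
proof -
  have "(x - y) * (x\<^sup>2 + x * y + y\<^sup>2 + b * (x + y) + c) = 0"
    using assms(1,2) by algebra
  then have xy: "x\<^sup>2 + x * y + y\<^sup>2 + b * (x + y) + c = 0" using assms(4) by simp
  have "(x - z) * (x\<^sup>2 + x * z + z\<^sup>2 + b * (x + z) + c) = 0"
    using assms(1,3) by algebra
  then have xz: "x\<^sup>2 + x * z + z\<^sup>2 + b * (x + z) + c = 0" using assms(5) by simp
  have "(y - z) * (x + y + z + b) = 0" using xy xz by algebra
  then have s: "x + y + z + b = 0" using assms(6) by simp
  then show "x + y + z = - b" by (simp add: eq_neg_iff_add_eq_0)
  show p: "x * y + x * z + y * z = c" using s xy by algebra
  show "x * y * z = - d" using s p assms(1) by algebra
qed

lemma monic_quartic_factor: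
  fixes w x y z :: "'a :: field"
  assumes "\<And>v. v \<in> {w, x, y, z} \<Longrightarrow> v ^ 4 + a * v ^ 3 + b * v\<^sup>2 + c * v + d = 0"
    and "card {w, x, y, z} = 4"
  shows "v ^ 4 + a * v ^ 3 + b * v\<^sup>2 + c * v + d = (v - w) * (v - x) * (v - y) * (v - z)"
proof -
  define p where "p = [:d, c, b, a, 1:]"
  define q where "q = [:-w, 1:] * [:-x, 1:] * [:-y, 1:] * [:-z, 1:]"
  have "p = q"
  proof (rule poly_eqI_degree_lead_coeff[where n = 4 and A = "{w, x, y, z}"])
    show "poly p v = poly q v" if "v \<in> {w, x, y, z}" for v
      using assms(1)[OF that] that by (auto simp: p_def q_def algebra_simps power_numeral_reduce)
  qed (use assms(2) in \<open>auto simp: p_def q_def numeral_eq_Suc\<close>)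
  then have "poly p v = poly q v" by simp
  then show ?thesis by (simp add: p_def q_def algebra_simps power_numeral_reduce)
qed

text \<open>To first order the moduli are 8 p and 2 p^3. The lower bound serves to separate v from
  the other roots of \<open>G3\<close>, the upper one to place the cube root of t in a given
  disc.\<close>

lemma cubic_bounds:
  assumes "cmod p < 1 / 20"
  shows "5 * cmod p \<le> cmod (cubic_mod p)" "cmod (cubic_mod p) \<le> 20 * cmod p"
    "cmod (cubic_comod p) \<le> 3 * cmod p ^ 3"
proof -
  have n: "cmod (2 + p) \<le> 205 / 100" "cmod (1 + 2 * p) \<ge> 9 / 10" "cmod (2 + p) \<ge> 195 / 100" "cmod (1 + 2 * p) \<le> 11 / 10"
    using norm_triangle_ineq[of 2 p] norm_diff_ineq[of 1 "2 * p"] norm_diff_ineq[of 2 p]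
      norm_triangle_ineq[of 1 "2 * p"] assms by (auto simp: norm_mult)
  have pos: "cmod (1 + 2 * p) > 0" using n by linarith
  have a: "cmod (2 + p) ^ 3 \<le> (205 / 100) ^ 3" "(9 / 10) ^ 3 \<le> cmod (1 + 2 * p) ^ 3"
    "(195 / 100) ^ 3 \<le> cmod (2 + p) ^ 3" "cmod (1 + 2 * p) ^ 3 \<le> (11 / 10) ^ 3"
    using n by (intro power_mono; simp)+
  have b: "5 * cmod (1 + 2 * p) ^ 3 \<le> cmod (2 + p) ^ 3" "cmod (2 + p) ^ 3 \<le> 20 * cmod (1 + 2 * p) ^ 3"
    using a by (simp_all add: power3_eq_cube)
  have e: "cmod (cubic_mod p) = cmod p * cmod (2 + p) ^ 3 / cmod (1 + 2 * p) ^ 3"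
    by (simp add: cubic_mod_def norm_divide norm_mult norm_power)
  show "5 * cmod p \<le> cmod (cubic_mod p)"
    unfolding e using pos mult_left_mono[OF b(1), of "cmod p"] by (simp add: pos_le_divide_eq algebra_simps)
  show "cmod (cubic_mod p) \<le> 20 * cmod p"
    unfolding e using pos mult_left_mono[OF b(2), of "cmod p"] by (simp add: pos_divide_le_eq algebra_simps)
  have "cmod (2 + p) \<le> 3 * cmod (1 + 2 * p)" using n by linarith
  from mult_left_mono[OF this, of "cmod p ^ 3"]
  have "cmod p ^ 3 * cmod (2 + p) / cmod (1 + 2 * p) \<le> 3 * cmod p ^ 3"
    using pos by (simp add: pos_divide_le_eq algebra_simps)
  then show "cmod (cubic_comod p) \<le> 3 * cmod p ^ 3"
    by (simp add: cubic_comod_def norm_divide norm_mult norm_power)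
qed

text \<open>Clearing denominators gives a quartic in P with the rational root P = -(2 + p) / (1 +
  2p). That root lies near -2, so a small P must be a root of the cubic cofactor.\<close>

lemma cubic_root_of_comod_eq_mod:
  assumes p: "cmod p < 1 / 20" and P: "cmod P < 1 / 20" and eq: "cubic_comod P = cubic_mod p"
  shows "P ^ 3 + 3 * p / (1 + 2 * p) * P\<^sup>2 + - 3 * p * (2 + p) / (1 + 2 * p)\<^sup>2 * P
          + - p * (2 + p)\<^sup>2 / (1 + 2 * p)\<^sup>2 = 0"
proof -
  define i where "i = inverse (1 + 2 * p)"
  have i: "i * (1 + 2 * p) = 1" using small_nonzero[OF p] by (simp add: i_def)
  have "P ^ 3 * (2 + P) = (p * (2 + p) ^ 3 * i ^ 3) * (1 + 2 * P)"
    using eq small_nonzero[OF P] by (simp add: cubic_mod_def cubic_comod_def i_def field_simps)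
  then have "((1 + 2 * p) * P + (2 + p)) * (P ^ 3 + 3 * p * i * P\<^sup>2 - 3 * p * (2 + p) * i\<^sup>2 * P
          - p * (2 + p)\<^sup>2 * i\<^sup>2) = 0"
    using i by algebra
  moreover have "(1 + 2 * p) * P + (2 + p) \<noteq> 0"
  proof
    assume "(1 + 2 * p) * P + (2 + p) = 0"
    then have "2 = - (p + P + 2 * (p * P))" by (simp add: algebra_simps eq_neg_iff_add_eq_0)
    then have "2 = cmod (p + P + 2 * (p * P))" by (metis norm_minus_cancel norm_numeral)
    also have "\<dots> \<le> cmod p + cmod P + 2 * (cmod p * cmod P)"
      by (intro order_trans[OF norm_triangle_ineq] add_mono) (auto simp: norm_mult norm_triangle_ineq)
    also have "\<dots> \<le> 1 / 20 + 1 / 20 + 2 * (1 / 20 * (1 / 20))"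
      using p P by (intro add_mono mult_mono mult_left_mono) auto
    finally show False by simp
  qed
  ultimately have "P ^ 3 + 3 * p * i * P\<^sup>2 - 3 * p * (2 + p) * i\<^sup>2 * P - p * (2 + p)\<^sup>2 * i\<^sup>2 = 0" by simp
  then show ?thesis by (simp add: i_def divide_inverse power_inverse)
qed

text \<open>\<open>A P\<close> will be the logarithmic derivative of \<open>cubic_mod P\<close> with
  respect to s, where \<open>s ^ 3 = cubic_comod P\<close>; the weight \<open>1 + 2 * P\<close> is
  the factor of the cubic transformation.\<close>

lemma sums_over_cubic_roots:
  fixes p P1 P2 P3 :: complex
  assumes p: "cmod p < 1 / 20"
    and nz: "1 + P1 \<noteq> 0" "1 + P2 \<noteq> 0" "1 + P3 \<noteq> 0"
    and e: "P1 + P2 + P3 = - (3 * p / (1 + 2 * p))"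
      "P1 * P2 + P1 * P3 + P2 * P3 = - 3 * p * (2 + p) / (1 + 2 * p)\<^sup>2"
      "P1 * P2 * P3 = - (- p * (2 + p)\<^sup>2 / (1 + 2 * p)\<^sup>2)"
  defines "A \<equiv> \<lambda>P. (1 - P)\<^sup>2 / (1 + P)\<^sup>2"
  shows "A P1 + A P2 + A P3 = (3 - 42 * p + 3 * p\<^sup>2) / (1 - p)\<^sup>2" (is ?th1)
    and "A P1 * (1 + 2 * P1) + A P2 * (1 + 2 * P2) + A P3 * (1 + 2 * P3) =
         27 * (1 + p)\<^sup>2 / ((1 - p)\<^sup>2 * (1 + 2 * p)) - 24" (is ?th2)
proof -
  define d where "d = 1 + 2 * p"
  define i where "i = inverse d"
  define k where "k = inverse (1 - p)"
  have i: "i * (1 + 2 * p) = 1" and k: "k * (1 - p) = 1"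
    using small_nonzero[OF p] by (simp_all add: i_def d_def k_def)
  \<comment> \<open>With w = 1 / (1 + P) one has A = (2w - 1)^2, so both sums reduce to power sums
    of the w's and to P1 + P2 + P3.\<close>
  define w1 w2 w3 where "w1 = inverse (1 + P1)" and "w2 = inverse (1 + P2)" and "w3 = inverse (1 + P3)"
  have w: "w1 * (1 + P1) = 1" "w2 * (1 + P2) = 1" "w3 * (1 + P3) = 1"
    using nz by (simp_all add: w1_def w2_def w3_def)
  have e': "P1 + P2 + P3 = - 3 * p * i" "P1 * P2 + P1 * P3 + P2 * P3 = - 3 * p * (2 + p) * i\<^sup>2"
    "P1 * P2 * P3 = p * (2 + p)\<^sup>2 * i\<^sup>2"
    using e by (simp_all add: i_def d_def divide_inverse power_inverse)
  have prod: "(1 + P1) * (1 + P2) * (1 + P3) = (1 - p)\<^sup>2 * (1 + p) * i\<^sup>2"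
    using e' i by algebra
  have W: "w1 * w2 * w3 * ((1 - p)\<^sup>2 * (1 + p) * i\<^sup>2) = 1"
    unfolding prod[symmetric] using w by algebra
  define j where "j = inverse (1 + p)"
  have j: "j * (1 + p) = 1" using small_nonzero[OF p] by (simp add: j_def)
  have W': "w1 * w2 * w3 = k\<^sup>2 * j * (1 + 2 * p)\<^sup>2"
    using W i j k by algebra
  have pairs: "(1 + P1) * (1 + P2) + (1 + P1) * (1 + P3) + (1 + P2) * (1 + P3) = 3 * (1 - p) * (1 + p) * i\<^sup>2"
    using e' i by algebra
  have "w1 + w2 + w3 = w1 * w2 * w3 * ((1 + P1) * (1 + P2) + (1 + P1) * (1 + P3) + (1 + P2) * (1 + P3))"
    using w by algebra
  also have "\<dots> = 3 * k"
    unfolding W' pairs using i j k by algebra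
  finally have s1: "w1 + w2 + w3 = 3 * k" .
  have "w1 * w2 + w1 * w3 + w2 * w3 = w1 * w2 * w3 * (3 + (P1 + P2 + P3))"
    using w by algebra
  also have "\<dots> = 3 * (1 + 2 * p) * k\<^sup>2"
    unfolding W' e' using i j k by algebra
  finally have s2: "w1 * w2 + w1 * w3 + w2 * w3 = 3 * (1 + 2 * p) * k\<^sup>2" .
  have s3: "w1\<^sup>2 + w2\<^sup>2 + w3\<^sup>2 = (3 - 12 * p) * k\<^sup>2"
    using s1 s2 by algebra
  have A: "A P1 = (2 * w1 - 1)\<^sup>2" "A P2 = (2 * w2 - 1)\<^sup>2" "A P3 = (2 * w3 - 1)\<^sup>2"
    using nz by (simp_all add: A_def w1_def w2_def w3_def field_simps power2_eq_square)
  have "A P1 + A P2 + A P3 = (3 - 42 * p + 3 * p\<^sup>2) * k\<^sup>2"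
    unfolding A using s1 s3 k by algebra
  then show ?th1 by (simp add: k_def divide_inverse power_inverse)
  have B: "(2 * w1 - 1)\<^sup>2 * (1 + 2 * P1) = - 4 * w1\<^sup>2 + 12 * w1 - 9 + 2 * (1 + P1)"
    "(2 * w2 - 1)\<^sup>2 * (1 + 2 * P2) = - 4 * w2\<^sup>2 + 12 * w2 - 9 + 2 * (1 + P2)"
    "(2 * w3 - 1)\<^sup>2 * (1 + 2 * P3) = - 4 * w3\<^sup>2 + 12 * w3 - 9 + 2 * (1 + P3)"
    using w by algebra+
  have "A P1 * (1 + 2 * P1) + A P2 * (1 + 2 * P2) + A P3 * (1 + 2 * P3) = 27 * (1 + p)\<^sup>2 * (k\<^sup>2 * i) - 24"
    unfolding A B using s1 s3 e'(1) i k by algebra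
  then show ?th2 by (simp add: k_def i_def d_def divide_inverse power_inverse)
qed

text \<open>\<open>cubic_comod\<close> has a triple zero at 0 and no local inverse there. Its cube
  root, with the factor P kept outside the exponential, has a simple zero and can be
  inverted.\<close>

definition cbrt_comod :: "complex \<Rightarrow> complex" where
  "cbrt_comod P = P * exp ((Ln (2 + P) - Ln (1 + 2 * P)) / 3)"

lemma cbrt_comod_0 [simp]: "cbrt_comod 0 = 0"
  by (simp add: cbrt_comod_def)

lemma cbrt_comod:
  shows "cbrt_comod holomorphic_on ball 0 (1 / 20)" "deriv cbrt_comod 0 \<noteq> 0"
    "\<And>P. cmod P < 1 / 20 \<Longrightarrow> cbrt_comod P ^ 3 = cubic_comod P"
proof -
  have re: "0 < Re (2 + P)" "0 < Re (1 + 2 * P)" if "cmod P < 1 / 20" for P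
    using abs_Re_le_cmod[of P] that by auto
  then have np: "2 + P \<notin> \<real>\<^sub>\<le>\<^sub>0" "1 + 2 * P \<notin> \<real>\<^sub>\<le>\<^sub>0" if "cmod P < 1 / 20" for P
    using that by (force simp: complex_nonpos_Reals_iff)+
  show hol: "cbrt_comod holomorphic_on ball 0 (1 / 20)"
    unfolding cbrt_comod_def[abs_def] by (intro holomorphic_intros) (use np in auto)
  define E where "E = (\<lambda>P. exp ((Ln (2 + P) - Ln (1 + 2 * P)) / 3))"
  have "E holomorphic_on ball 0 (1 / 20)"
    unfolding E_def by (intro holomorphic_intros) (use np in auto)
  then have "(E has_field_derivative deriv E 0) (at 0)"
    by (rule holomorphic_derivI) auto
  then have "((\<lambda>P. P * E P) has_field_derivative 1 * E 0 + deriv E 0 * 0) (at 0)"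
    by (intro DERIV_mult DERIV_ident)
  moreover have "cbrt_comod = (\<lambda>P. P * E P)" by (simp add: cbrt_comod_def E_def fun_eq_iff)
  ultimately have "deriv cbrt_comod 0 = E 0" by (simp add: DERIV_imp_deriv)
  then show "deriv cbrt_comod 0 \<noteq> 0" by (simp add: E_def)
  show "cbrt_comod P ^ 3 = cubic_comod P" if P: "cmod P < 1 / 20" for P
  proof -
    have "cbrt_comod P ^ 3 = P ^ 3 * exp (3 * ((Ln (2 + P) - Ln (1 + 2 * P)) / 3))"
      unfolding cbrt_comod_def power_mult_distrib by (subst exp_of_nat_mult[of 3, symmetric]) simp
    also have "3 * ((Ln (2 + P) - Ln (1 + 2 * P)) / 3) = Ln (2 + P) - Ln (1 + 2 * P)"
      by simp
    also have "P ^ 3 * exp \<dots> = P ^ 3 * ((2 + P) / (1 + 2 * P))"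
      using small_nonzero[OF P] by (simp add: exp_diff)
    finally show ?thesis by (simp add: cubic_comod_def)
  qed
qed

text \<open>
  The Hecke relation for the prime 3: \<open>u\<^sub>1, u\<^sub>2, u\<^sub>3\<close> and \<open>cubic_comod p\<close> are the four moduli
  3-isogenous to \<open>cubic_mod p\<close>. In terms of \<open>s\<close> with \<open>s ^ 3 = cubic_mod p\<close> the \<open>u\<^sub>j\<close> are the
  values of one holomorphic function at \<open>s\<close>, \<open>\<omega> s\<close>, \<open>\<omega>\<^sup>2 s\<close>; the cubic transformation turns the
  logarithmic derivative of the relation into identities between symmetric functions of three
  roots of a cubic equation.
\<close>
lemma log_mean_hecke_3:
  obtains \<epsilon> where "\<epsilon> > 0" "\<epsilon> \<le> 1 / 20"
    "\<And>p. 0 < cmod p \<Longrightarrow> cmod p < \<epsilon> \<Longrightarrow>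
      \<exists>u1 u2 u3. cmod u1 < 1 \<and> cmod u2 < 1 \<and> cmod u3 < 1 \<and>
        (\<forall>z. G3 z (cubic_mod p) = (z - cubic_comod p) * (z - u1) * (z - u2) * (z - u3)) \<and>
        log_mean u1 + log_mean u2 + log_mean u3 =
          3 * log_mean (cubic_comod p) - 8 * log_mean (cubic_mod p) + 32 * Ln (1 + p / 2) - 32 * Ln (1 + 2 * p)"
proof -
  obtain r where r: "0 < r" "r \<le> 1 / 20"
    and trans: "\<And>p. cmod p < r \<Longrightarrow> hyp (cubic_mod p) = (1 + 2 * p) * hyp (cubic_comod p)"
    using hyp_cubic_transformation by blast
  have nz1: "1 + 2 * p \<noteq> 0" if "cmod p < r" for p using small_nonzero(1)[of p] that r by simp
  have hol_mod: "cubic_mod holomorphic_on ball 0 r"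
    unfolding cubic_mod_def[abs_def] by (intro holomorphic_intros) (use nz1 in auto)
  have deriv_mod: "deriv cubic_mod 0 \<noteq> 0"
    using DERIV_imp_deriv[OF has_field_derivative_cubic_mod[of 0 UNIV]] by simp
  obtain q \<rho>1 \<delta> where q: "\<rho>1 > 0" "\<delta> > 0" "q holomorphic_on ball 0 \<rho>1" "q 0 = 0"
    "\<And>w. cmod w < \<rho>1 \<Longrightarrow> q w \<in> ball 0 r" "\<And>w. cmod w < \<rho>1 \<Longrightarrow> cubic_mod (q w) = w"
    "\<And>z. cmod z < \<delta> \<Longrightarrow> q (cubic_mod z) = z"
    by (rule holomorphic_local_inverse[OF hol_mod open_ball _ cubic_0(1) deriv_mod]) (simp add: r(1), blast)
  \<comment> \<open>The ball is cut down to radius \<delta> so that q undoes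
    \<open>cubic_mod\<close> at the values of \<psi>; this later makes the three moduli
    distinct.\<close>
  have hol_cbrt: "cbrt_comod holomorphic_on ball 0 (min r \<delta>)"
    using cbrt_comod(1) r(2) by (elim holomorphic_on_subset) auto
  obtain \<psi> \<rho>2 where \<psi>: "\<rho>2 > 0" "\<psi> holomorphic_on ball 0 \<rho>2" "\<psi> 0 = 0"
    "\<And>w. cmod w < \<rho>2 \<Longrightarrow> \<psi> w \<in> ball 0 (min r \<delta>)" "\<And>w. cmod w < \<rho>2 \<Longrightarrow> cbrt_comod (\<psi> w) = w"
    by (rule holomorphic_local_inverse[OF hol_cbrt open_ball _ cbrt_comod_0 cbrt_comod(2)])
       (simp add: r(1) q(2), blast)
  define \<rho> where "\<rho> = Min {\<rho>1, \<rho>2, 1}"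
  have \<rho>: "\<rho> > 0" "\<rho> \<le> \<rho>1" "\<rho> \<le> \<rho>2" "\<rho> \<le> 1" using q(1) \<psi>(1) by (auto simp: \<rho>_def)
  have cube_less: "cmod (s ^ 3) < \<rho>" if "cmod s < \<rho>" for s
  proof -
    have "cmod s ^ 3 \<le> cmod s ^ 1" using that \<rho>(4) by (intro power_decreasing) auto
    then show ?thesis using that by (simp add: norm_power)
  qed
  have \<psi>_small: "cmod (\<psi> s) < 1 / 20" "cmod (\<psi> s) < r" "cmod (\<psi> s) < \<delta>" if "cmod s < \<rho>" for s
    using \<psi>(4)[of s] that \<rho> r by auto
  have \<psi>_cube: "cubic_comod (\<psi> s) = s ^ 3" if "cmod s < \<rho>" for s
    using cbrt_comod(3)[OF \<psi>_small(1)[OF that]] \<psi>(5)[of s] that \<rho> by simp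
  have \<psi>_inj: "s = s'" if "cmod s < \<rho>" "cmod s' < \<rho>" "\<psi> s = \<psi> s'" for s s'
    using \<psi>(5)[of s] \<psi>(5)[of s'] that \<rho>(3) by (metis order_less_le_trans)
  have q_small: "cmod (q x) < 1 / 20" "cmod (q x) < r" if "cmod x < \<rho>" for x
    using q(5)[of x] that \<rho> r by auto
  have q_inv: "cubic_mod (q x) = x" if "cmod x < \<rho>" for x using q(6)[of x] that \<rho> by simp
  define A where "A = (\<lambda>P :: complex. (1 - P)\<^sup>2 / (1 + P)\<^sup>2)"

  \<comment> \<open>With U = \<open>cubic_mod (\<psi> s)\<close>, the operator s d/ds applied to
    \<open>log_mean U\<close> gives the logarithmic derivative A of U times U
    \<open>log_mean' U\<close> = 1 - \<open>hyp U\<close>. Since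
    \<open>cubic_comod (\<psi> s) = s ^ 3\<close>, the cubic transformation replaces
    \<open>hyp U\<close> by a multiple of \<open>hyp (s ^ 3)\<close>, the same for all three cube
    roots.\<close>
  have deriv_u: "\<exists>D. ((\<lambda>s. log_mean (cubic_mod (\<psi> s))) has_field_derivative D) (at s) \<and>
      s * D = A (\<psi> s) - A (\<psi> s) * (1 + 2 * \<psi> s) * hyp (s ^ 3)" if s: "cmod s < \<rho>" "s \<noteq> 0" for s
  proof -
    define P where "P = \<psi> s"
    define d where "d = 1 + 2 * P"
    define U where "U = cubic_mod P"
    have P: "cmod P < 1 / 20" using \<psi>_small[OF s(1)] by (simp add: P_def)
    note nz = small_nonzero[OF P]
    have P0: "P \<noteq> 0" using \<psi>_inj[of s 0] \<psi>(3) s \<rho>(1) by (auto simp: P_def)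
    have D\<psi>: "(\<psi> has_field_derivative deriv \<psi> s) (at s)"
      using s \<rho> by (intro holomorphic_derivI[OF \<psi>(2)]) auto
    have "((\<lambda>s. cubic_comod (\<psi> s)) has_field_derivative 6 * P\<^sup>2 * (1 + P)\<^sup>2 / d\<^sup>2 * deriv \<psi> s) (at s)"
      unfolding P_def d_def
      by (rule DERIV_chain2[OF has_field_derivative_cubic_comod D\<psi>]) (use nz in \<open>simp add: P_def\<close>)
    moreover have "\<forall>\<^sub>F w in nhds s. cubic_comod (\<psi> w) = w ^ 3"
      using eventually_nhds_in_open[of "ball 0 \<rho>" s] s \<psi>_cube by (auto elim!: eventually_mono)
    ultimately have "((\<lambda>w. w ^ 3) has_field_derivative 6 * P\<^sup>2 * (1 + P)\<^sup>2 / d\<^sup>2 * deriv \<psi> s) (at s)"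
      by (subst (asm) DERIV_cong_ev[OF refl _ refl])
    moreover have "((\<lambda>w. w ^ 3) has_field_derivative 3 * s\<^sup>2) (at s)"
      by (auto intro!: derivative_eq_intros)
    ultimately have "6 * P\<^sup>2 * (1 + P)\<^sup>2 / d\<^sup>2 * deriv \<psi> s = 3 * s\<^sup>2"
      by (rule DERIV_unique)
    then have d1: "2 * P\<^sup>2 * (1 + P)\<^sup>2 * deriv \<psi> s = s\<^sup>2 * d\<^sup>2"
      using nz by (simp add: d_def field_simps)
    have cube: "P ^ 3 * (2 + P) = s ^ 3 * d"
      using \<psi>_cube[OF s(1)] nz by (simp add: cubic_comod_def P_def d_def field_simps)
    \<comment> \<open>Multiplying the implicit derivative by s brings in s^3, which is rational in
      P; thus s times the derivative of \<psi> is rational in P.\<close>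
    have "P\<^sup>2 * (2 * (1 + P)\<^sup>2 * (s * deriv \<psi> s)) = P\<^sup>2 * (P * (2 + P) * d)"
      using d1 cube by algebra
    then have d2: "2 * (1 + P)\<^sup>2 * (s * deriv \<psi> s) = P * (2 + P) * d" using P0 by simp
    define U' where "U' = 2 * (2 + P)\<^sup>2 * (1 - P)\<^sup>2 / d ^ 4"
    have DU: "((\<lambda>s. cubic_mod (\<psi> s)) has_field_derivative U' * deriv \<psi> s) (at s)"
      unfolding P_def d_def U'_def
      by (rule DERIV_chain2[OF has_field_derivative_cubic_mod D\<psi>]) (use nz in \<open>simp add: P_def\<close>)
    have lt: "cmod U < 1" using norm_cubic_less_1[OF P] by (simp add: U_def)
    have "((\<lambda>s. log_mean (cubic_mod (\<psi> s))) has_field_derivative log_mean' U * (U' * deriv \<psi> s)) (at s)"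
      unfolding U_def P_def
      by (rule DERIV_chain2[OF has_field_derivative_log_mean DU]) (use lt in \<open>simp add: U_def P_def\<close>)
    moreover have "s * (log_mean' U * (U' * deriv \<psi> s)) = A P - A P * (1 + 2 * P) * hyp (s ^ 3)"
    proof -
      have "U' * (s * deriv \<psi> s) = U * A P"
      proof -
        define j where "j = inverse (1 + P)"
        define i where "i = inverse d"
        have j: "j * (1 + P) = 1" and i: "i * d = 1"
          using nz by (simp_all add: j_def i_def d_def)
        have "s * deriv \<psi> s * 2 = P * (2 + P) * d * j\<^sup>2" using d2 j by algebra
        moreover have "U' = 2 * (2 + P)\<^sup>2 * (1 - P)\<^sup>2 * i ^ 4" "U = P * (2 + P) ^ 3 * i ^ 3" "A P = (1 - P)\<^sup>2 * j\<^sup>2"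
          by (simp_all add: U'_def U_def cubic_mod_def A_def j_def i_def d_def field_simps)
        ultimately show ?thesis using i by algebra
      qed
      then have "s * (log_mean' U * (U' * deriv \<psi> s)) = A P * (U * log_mean' U)" by algebra
      also have "U * log_mean' U = 1 - (1 + 2 * P) * hyp (s ^ 3)"
        using log_mean'_hyp[OF lt] trans[of P] \<psi>_small[OF s(1)] \<psi>_cube[OF s(1)] by (simp add: U_def P_def)
      finally show ?thesis by (simp add: algebra_simps)
    qed
    ultimately show ?thesis unfolding P_def by blast
  qed

  have deriv_q: "s * (deriv q (s ^ 3) * (3 * s\<^sup>2)) = 3 * (q (s ^ 3) * (2 + q (s ^ 3)) * (1 + 2 * q (s ^ 3))) / (2 * (1 - q (s ^ 3))\<^sup>2)"
    and deriv_q': "((\<lambda>s. q (s ^ 3)) has_field_derivative deriv q (s ^ 3) * (3 * s\<^sup>2)) (at s)"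
    if s: "cmod s < \<rho>" for s
  proof -
    define x where "x = s ^ 3"
    define p where "p = q x"
    have x: "cmod x < \<rho>" unfolding x_def by (rule cube_less[OF s])
    have p: "cmod p < 1 / 20" using q_small[OF x] by (simp add: p_def)
    note nz = small_nonzero[OF p]
    have Dq: "(q has_field_derivative deriv q x) (at x)"
      using x \<rho> by (intro holomorphic_derivI[OF q(3)]) auto
    have "((\<lambda>x. cubic_mod (q x)) has_field_derivative 2 * (2 + p)\<^sup>2 * (1 - p)\<^sup>2 / (1 + 2 * p) ^ 4 * deriv q x) (at x)"
      unfolding p_def by (rule DERIV_chain2[OF has_field_derivative_cubic_mod Dq]) (use nz in \<open>simp add: p_def\<close>)
    moreover have "\<forall>\<^sub>F w in nhds x. cubic_mod (q w) = w"
      using eventually_nhds_in_open[of "ball 0 \<rho>" x] x q_inv by (auto elim!: eventually_mono)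
    ultimately have "((\<lambda>w. w) has_field_derivative 2 * (2 + p)\<^sup>2 * (1 - p)\<^sup>2 / (1 + 2 * p) ^ 4 * deriv q x) (at x)"
      by (subst (asm) DERIV_cong_ev[OF refl _ refl])
    then have d1: "2 * (2 + p)\<^sup>2 * (1 - p)\<^sup>2 / (1 + 2 * p) ^ 4 * deriv q x = 1"
      by (rule DERIV_unique) (rule DERIV_ident)
    have xe: "x = p * (2 + p) ^ 3 / (1 + 2 * p) ^ 3"
      using q_inv[OF x] by (simp add: p_def cubic_mod_def)
    have "x * deriv q x = p * (2 + p) * (1 + 2 * p) / (2 * (1 - p)\<^sup>2)"
    proof -
      define i where "i = inverse (1 + 2 * p)"
      define j where "j = inverse (2 * (1 - p)\<^sup>2)"
      define e where "e = inverse (2 + p)"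
      have i: "i * (1 + 2 * p) = 1" and j: "j * (2 * (1 - p)\<^sup>2) = 1" and e: "e * (2 + p) = 1"
        using nz by (simp_all add: i_def j_def e_def)
      have "2 * (2 + p)\<^sup>2 * (1 - p)\<^sup>2 * i ^ 4 * deriv q x = 1"
        using d1 by (simp add: i_def divide_inverse power_inverse mult_ac)
      then have "deriv q x = (1 + 2 * p) ^ 4 * j * e\<^sup>2" using i j e by algebra
      moreover have "x = p * (2 + p) ^ 3 * i ^ 3"
        using xe by (simp add: i_def divide_inverse power_inverse)
      ultimately have "x * deriv q x = p * (2 + p) * (1 + 2 * p) * j" using i e by algebra
      then show ?thesis unfolding j_def divide_inverse .
    qed
    then have "3 * (x * deriv q x) = 3 * (p * (2 + p) * (1 + 2 * p)) / (2 * (1 - p)\<^sup>2)"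
      by (simp only: times_divide_eq_right)
    moreover have "s * (deriv q x * (3 * s\<^sup>2)) = 3 * (x * deriv q x)"
      by (simp add: x_def power2_eq_square power3_eq_cube)
    ultimately show "s * (deriv q (s ^ 3) * (3 * s\<^sup>2)) =
        3 * (q (s ^ 3) * (2 + q (s ^ 3)) * (1 + 2 * q (s ^ 3))) / (2 * (1 - q (s ^ 3))\<^sup>2)"
      unfolding p_def x_def by simp
    have c: "((\<lambda>s. s ^ 3) has_field_derivative 3 * s\<^sup>2) (at s)"
      by (auto intro!: derivative_eq_intros)
    show "((\<lambda>s. q (s ^ 3)) has_field_derivative deriv q (s ^ 3) * (3 * s\<^sup>2)) (at s)"
      by (rule DERIV_chain2[OF Dq[unfolded x_def] c])
  qed

  have deriv_v: "\<exists>D. ((\<lambda>s. log_mean (cubic_comod (q (s ^ 3)))) has_field_derivative D) (at s) \<and>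
      s * D = 9 * (1 + q (s ^ 3))\<^sup>2 / (1 - q (s ^ 3))\<^sup>2 * (1 - hyp (cubic_comod (q (s ^ 3))))"
    if s: "cmod s < \<rho>" for s
  proof -
    define p where "p = q (s ^ 3)"
    define V where "V = cubic_comod p"
    define q' where "q' = deriv q (s ^ 3) * (3 * s\<^sup>2)"
    have p: "cmod p < 1 / 20" using q_small[OF cube_less[OF s]] by (simp add: p_def)
    note nz = small_nonzero[OF p]
    have lt: "cmod V < 1" using norm_cubic_less_1[OF p] by (simp add: V_def)
    have sq': "s * q' = 3 * (p * (2 + p) * (1 + 2 * p)) / (2 * (1 - p)\<^sup>2)"
      using deriv_q[OF s] by (simp only: p_def q'_def)
    have DV: "((\<lambda>s. cubic_comod (q (s ^ 3))) has_field_derivative 6 * p\<^sup>2 * (1 + p)\<^sup>2 / (1 + 2 * p)\<^sup>2 * q') (at s)"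
      unfolding p_def q'_def
      by (rule DERIV_chain2[OF has_field_derivative_cubic_comod deriv_q'[OF s]]) (use nz in \<open>simp add: p_def\<close>)
    have "((\<lambda>s. log_mean (cubic_comod (q (s ^ 3)))) has_field_derivative
        log_mean' V * (6 * p\<^sup>2 * (1 + p)\<^sup>2 / (1 + 2 * p)\<^sup>2 * q')) (at s)"
      unfolding V_def p_def
      by (rule DERIV_chain2[OF has_field_derivative_log_mean DV[unfolded p_def]]) (use lt in \<open>simp add: V_def p_def\<close>)
    moreover have "s * (log_mean' V * (6 * p\<^sup>2 * (1 + p)\<^sup>2 / (1 + 2 * p)\<^sup>2 * q')) =
        9 * (1 + p)\<^sup>2 / (1 - p)\<^sup>2 * (1 - hyp V)"
    proof -
      have "6 * p\<^sup>2 * (1 + p)\<^sup>2 / (1 + 2 * p)\<^sup>2 * (s * q') = 9 * (1 + p)\<^sup>2 / (1 - p)\<^sup>2 * V"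
        unfolding sq' V_def cubic_comod_def using nz by (simp add: divide_simps) algebra
      then have "s * (log_mean' V * (6 * p\<^sup>2 * (1 + p)\<^sup>2 / (1 + 2 * p)\<^sup>2 * q')) =
          9 * (1 + p)\<^sup>2 / (1 - p)\<^sup>2 * (V * log_mean' V)"
      proof -
        have "X * (s * q') = Y * V \<Longrightarrow> s * (l * (X * q')) = Y * (V * l)" for X Y l by algebra
        then show "6 * p\<^sup>2 * (1 + p)\<^sup>2 / (1 + 2 * p)\<^sup>2 * (s * q') = 9 * (1 + p)\<^sup>2 / (1 - p)\<^sup>2 * V
          \<Longrightarrow> ?thesis" .
      qed
      then show ?thesis by (simp only: log_mean'_hyp[OF lt])
    qed
    ultimately show ?thesis unfolding V_def p_def by blast
  qed

  define \<omega> where "\<omega> = cis (2 * pi / 3)"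
  have \<omega>3: "\<omega> ^ 3 = 1"
    unfolding \<omega>_def Complex.DeMoivre by (simp add: cis_2pi[simplified])
  have \<omega>1: "\<omega> \<noteq> 1"
    by (auto simp: \<omega>_def complex_eq_iff cos_120)
  have \<omega>2: "\<omega>\<^sup>2 \<noteq> 1" "\<omega>\<^sup>2 \<noteq> \<omega>"
    using \<omega>3 \<omega>1 by (auto simp: power2_eq_square power3_eq_cube)
  have norm_\<omega>: "cmod \<omega> = 1" by (simp add: \<omega>_def)
  have rotate_small: "cmod (\<omega> * s) < \<rho>" "cmod (\<omega>\<^sup>2 * s) < \<rho>" if "cmod s < \<rho>" for s
    using that norm_\<omega> by (simp_all add: norm_mult norm_power)
  have rotate_cube: "(\<omega> * s) ^ 3 = s ^ 3" "(\<omega>\<^sup>2 * s) ^ 3 = s ^ 3" for s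
  proof -
    show "(\<omega> * s) ^ 3 = s ^ 3" "(\<omega>\<^sup>2 * s) ^ 3 = s ^ 3" using \<omega>3 by algebra+
  qed
  have distinct: "\<psi> s \<noteq> \<psi> (\<omega> * s)" "\<psi> s \<noteq> \<psi> (\<omega>\<^sup>2 * s)" "\<psi> (\<omega> * s) \<noteq> \<psi> (\<omega>\<^sup>2 * s)"
    if s: "cmod s < \<rho>" "s \<noteq> 0" for s
    using \<psi>_inj[of s "\<omega> * s"] \<psi>_inj[of s "\<omega>\<^sup>2 * s"] \<psi>_inj[of "\<omega> * s" "\<omega>\<^sup>2 * s"] rotate_small[OF s(1)] s \<omega>1 \<omega>2
    by auto

  \<comment> \<open>Difference of the two sides, as a function of s. The logarithms stand for 4 log
    (t^3 / v): here t^3 / v is the eighth power of (2 + p) / (1 + 2p), whence 32, and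
    \<open>1 + p / 2\<close> in place of \<open>2 + p\<close> makes them vanish at 0.\<close>
  define \<Xi> where "\<Xi> = (\<lambda>s. log_mean (cubic_mod (\<psi> s)) + log_mean (cubic_mod (\<psi> (\<omega> * s)))
      + log_mean (cubic_mod (\<psi> (\<omega>\<^sup>2 * s))) - 3 * log_mean (cubic_comod (q (s ^ 3))) + 8 * log_mean (s ^ 3)
      - 32 * Ln (1 + q (s ^ 3) / 2) + 32 * Ln (1 + 2 * q (s ^ 3)))"

  have deriv_\<Xi>: "(\<Xi> has_field_derivative 0) (at s)" if s: "cmod s < \<rho>" "s \<noteq> 0" for s
  proof -
    define p where "p = q (s ^ 3)"
    define y where "y = hyp (cubic_comod p)"
    define P1 P2 P3 where "P1 = \<psi> s" and "P2 = \<psi> (\<omega> * s)" and "P3 = \<psi> (\<omega>\<^sup>2 * s)"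
    have p: "cmod p < 1 / 20" "cubic_mod p = s ^ 3" and hyp_s: "hyp (s ^ 3) = (1 + 2 * p) * y"
      using q_small[OF cube_less[OF s(1)]] q_inv[OF cube_less[OF s(1)]] trans[of p]
      by (simp_all add: p_def y_def)
    note nz = small_nonzero[OF p(1)]
    have P: "cmod P1 < 1 / 20" "cmod P2 < 1 / 20" "cmod P3 < 1 / 20"
      using \<psi>_small rotate_small[OF s(1)] s(1) by (simp_all add: P1_def P2_def P3_def)
    have comod: "cubic_comod P1 = cubic_mod p" "cubic_comod P2 = cubic_mod p" "cubic_comod P3 = cubic_mod p"
      using \<psi>_cube rotate_small[OF s(1)] s(1) p(2) rotate_cube by (simp_all add: P1_def P2_def P3_def)
    note e = vieta_cubic[OF cubic_root_of_comod_eq_mod[OF p(1) P(1) comod(1)]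
      cubic_root_of_comod_eq_mod[OF p(1) P(2) comod(2)] cubic_root_of_comod_eq_mod[OF p(1) P(3) comod(3)]
      distinct[OF s, folded P1_def P2_def P3_def]]
    have sumA: "A P1 + A P2 + A P3 = (3 - 42 * p + 3 * p\<^sup>2) / (1 - p)\<^sup>2"
      and sumB: "A P1 * (1 + 2 * P1) + A P2 * (1 + 2 * P2) + A P3 * (1 + 2 * P3) =
         27 * (1 + p)\<^sup>2 / ((1 - p)\<^sup>2 * (1 + 2 * p)) - 24"
      unfolding A_def using sums_over_cubic_roots[OF p(1) _ _ _ e] small_nonzero(3) P by auto
    obtain D1 where D1: "((\<lambda>s. log_mean (cubic_mod (\<psi> s))) has_field_derivative D1) (at s)"
      "s * D1 = A P1 - A P1 * (1 + 2 * P1) * hyp (s ^ 3)"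
      using deriv_u[OF s] unfolding P1_def by blast
    obtain D2 where D2: "((\<lambda>s. log_mean (cubic_mod (\<psi> s))) has_field_derivative D2) (at (\<omega> * s))"
      "\<omega> * s * D2 = A P2 - A P2 * (1 + 2 * P2) * hyp (s ^ 3)"
      using deriv_u[of "\<omega> * s"] rotate_small[OF s(1)] s(2) norm_\<omega> unfolding P2_def rotate_cube
      by (metis mult_eq_0_iff norm_eq_zero zero_neq_one)
    obtain D3 where D3: "((\<lambda>s. log_mean (cubic_mod (\<psi> s))) has_field_derivative D3) (at (\<omega>\<^sup>2 * s))"
      "\<omega>\<^sup>2 * s * D3 = A P3 - A P3 * (1 + 2 * P3) * hyp (s ^ 3)"
      using deriv_u[of "\<omega>\<^sup>2 * s"] rotate_small[OF s(1)] s(2) norm_\<omega> unfolding P3_def rotate_cube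
      by (metis mult_eq_0_iff norm_eq_zero zero_neq_one power_eq_0_iff)
    obtain D4 where D4: "((\<lambda>s. log_mean (cubic_comod (q (s ^ 3)))) has_field_derivative D4) (at s)"
      "s * D4 = 9 * (1 + p)\<^sup>2 / (1 - p)\<^sup>2 * (1 - y)"
      using deriv_v[OF s(1)] unfolding p_def y_def by blast
    have rot: "((\<lambda>s. c * s) has_field_derivative c) (at s)" for c :: complex
      by (auto intro!: derivative_eq_intros)
    have D2': "((\<lambda>s. log_mean (cubic_mod (\<psi> (\<omega> * s)))) has_field_derivative D2 * \<omega>) (at s)"
      by (rule DERIV_chain2[OF D2(1) rot])
    have D3': "((\<lambda>s. log_mean (cubic_mod (\<psi> (\<omega>\<^sup>2 * s)))) has_field_derivative D3 * \<omega>\<^sup>2) (at s)"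
      by (rule DERIV_chain2[OF D3(1) rot])
    have s1: "cmod (s ^ 3) < 1" using cube_less[OF s(1)] \<rho>(4) by simp
    have cube: "((\<lambda>s. s ^ 3) has_field_derivative 3 * s\<^sup>2) (at s)"
      by (auto intro!: derivative_eq_intros)
    have D5: "((\<lambda>s. log_mean (s ^ 3)) has_field_derivative log_mean' (s ^ 3) * (3 * s\<^sup>2)) (at s)"
      by (rule DERIV_chain2[OF has_field_derivative_log_mean cube]) (rule s1)
    have D5': "s * (log_mean' (s ^ 3) * (3 * s\<^sup>2)) = 3 * (1 - (1 + 2 * p) * y)"
    proof -
      have "s * (log_mean' (s ^ 3) * (3 * s\<^sup>2)) = 3 * (s ^ 3 * log_mean' (s ^ 3))"
        by (simp add: power2_eq_square power3_eq_cube)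
      then show ?thesis by (simp only: log_mean'_hyp[OF s1] hyp_s)
    qed
    define q' where "q' = deriv q (s ^ 3) * (3 * s\<^sup>2)"
    have sq': "s * q' = 3 * (p * (2 + p) * (1 + 2 * p)) / (2 * (1 - p)\<^sup>2)"
      using deriv_q[OF s(1)] by (simp only: p_def q'_def)
    have np: "1 + p / 2 \<notin> \<real>\<^sub>\<le>\<^sub>0" "1 + 2 * p \<notin> \<real>\<^sub>\<le>\<^sub>0"
      using abs_Re_le_cmod[of p] p(1) by (auto simp: complex_nonpos_Reals_iff)
    have D6: "((\<lambda>s. Ln (1 + q (s ^ 3) / 2)) has_field_derivative q' / (2 + p)) (at s)"
    proof -
      have "((\<lambda>s. 1 + q (s ^ 3) / 2) has_field_derivative q' / 2) (at s)"
        unfolding q'_def by (rule derivative_eq_intros deriv_q'[OF s(1)] refl | simp)+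
      from DERIV_chain2[OF has_field_derivative_Ln[OF np(1)[unfolded p_def]] this]
      have "((\<lambda>s. Ln (1 + q (s ^ 3) / 2)) has_field_derivative inverse (1 + p / 2) * (q' / 2)) (at s)"
        unfolding p_def .
      moreover have "q' / (2 * (1 + p / 2)) = inverse (1 + p / 2) * (q' / 2)"
        by (simp only: divide_inverse inverse_mult_distrib mult_ac)
      moreover have "2 * (1 + p / 2) = 2 + p" by simp
      ultimately show ?thesis by (simp only:)
    qed
    have D7: "((\<lambda>s. Ln (1 + 2 * q (s ^ 3))) has_field_derivative 2 * q' / (1 + 2 * p)) (at s)"
    proof -
      have "((\<lambda>s. 1 + 2 * q (s ^ 3)) has_field_derivative 2 * q') (at s)"
        unfolding q'_def by (rule derivative_eq_intros deriv_q'[OF s(1)] refl | simp)+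
      from DERIV_chain2[OF has_field_derivative_Ln[OF np(2)[unfolded p_def]] this]
      show ?thesis unfolding p_def by (simp add: divide_inverse mult.commute)
    qed
    define D where "D = D1 + D2 * \<omega> + D3 * \<omega>\<^sup>2 - 3 * D4 + 8 * (log_mean' (s ^ 3) * (3 * s\<^sup>2))
        - 32 * (q' / (2 + p)) + 32 * (2 * q' / (1 + 2 * p))"
    have "(\<Xi> has_field_derivative D) (at s)"
      unfolding \<Xi>_def D_def
      by (intro DERIV_add DERIV_diff DERIV_cmult D1(1) D2' D3' D4(1) D5 D6 D7)
    \<comment> \<open>Everything is linear in y. The coefficient of y cancels by
      \<open>sumB\<close>; the rest cancels by \<open>sumA\<close> up to -144 p / (1 - p)^2, which
      the two logarithms compensate.\<close>
    moreover have "s * D = 0"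
    proof -
      define b where "b = (1 + p)\<^sup>2 / (1 - p)\<^sup>2"
      have "s * D = s * D1 + \<omega> * s * D2 + \<omega>\<^sup>2 * s * D3 - 3 * (s * D4) + 8 * (s * (log_mean' (s ^ 3) * (3 * s\<^sup>2)))
          - 32 * ((s * q') * (1 / (2 + p) - 2 / (1 + 2 * p)))"
        by (simp add: D_def algebra_simps)
      also have "\<dots> = (A P1 + A P2 + A P3)
          - (A P1 * (1 + 2 * P1) + A P2 * (1 + 2 * P2) + A P3 * (1 + 2 * P3)) * ((1 + 2 * p) * y)
          - 27 * b * (1 - y) + 24 * (1 - (1 + 2 * p) * y)
          - 32 * ((s * q') * (1 / (2 + p) - 2 / (1 + 2 * p)))"
        unfolding D1(2) D2(2) D3(2) D4(2) D5' hyp_s b_def by (simp add: algebra_simps)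
      also have "(s * q') * (1 / (2 + p) - 2 / (1 + 2 * p)) = - 9 * p / (2 * (1 - p)\<^sup>2)"
        unfolding sq' using nz by (simp add: divide_simps)
      also have "(A P1 * (1 + 2 * P1) + A P2 * (1 + 2 * P2) + A P3 * (1 + 2 * P3)) * ((1 + 2 * p) * y)
          = 27 * b * y - 24 * (1 + 2 * p) * y"
        unfolding sumB b_def using nz by (simp add: divide_simps) algebra
      also have "A P1 + A P2 + A P3 = 27 * b - 24 - 144 * p / (1 - p)\<^sup>2"
        unfolding sumA b_def using nz by (simp add: divide_simps) algebra
      finally show ?thesis by (simp add: algebra_simps)
    qed
    ultimately show ?thesis using s(2) by simp
  qed

  have \<Xi>_0: "\<Xi> s = 0" if s: "cmod s < \<rho>" for s
  proof -
    have log_mean: "continuous_on (ball 0 1) log_mean"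
      by (rule DERIV_continuous_on[OF has_field_derivative_log_mean]) auto
    have cont_\<psi>: "continuous_on (ball 0 \<rho>) \<psi>"
      using \<psi>(2) \<rho>(3) by (intro holomorphic_on_imp_continuous_on) (auto elim: holomorphic_on_subset)
    have cont_u: "continuous_on (ball 0 \<rho>) (\<lambda>s. log_mean (cubic_mod (\<psi> s)))"
    proof (rule continuous_on_compose2[OF log_mean])
      show "continuous_on (ball 0 \<rho>) (\<lambda>s. cubic_mod (\<psi> s))"
        unfolding cubic_mod_def using small_nonzero(1)[OF \<psi>_small(1)]
        by (intro continuous_intros cont_\<psi>) auto
      show "(\<lambda>s. cubic_mod (\<psi> s)) ` ball 0 \<rho> \<subseteq> ball 0 1"
        using norm_cubic_less_1[OF \<psi>_small(1)] by auto
    qed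
    have cont_rot: "continuous_on (ball 0 \<rho>) (\<lambda>s. log_mean (cubic_mod (\<psi> (c * s))))" if "cmod c = 1" for c
      by (rule continuous_on_compose2[OF cont_u]) (use that in \<open>auto intro!: continuous_intros simp: norm_mult\<close>)
    have cont_q: "continuous_on (ball 0 \<rho>) (\<lambda>s. q (s ^ 3))"
      using deriv_q' by (intro continuous_at_imp_continuous_on ballI DERIV_isCont) auto
    have q3: "cmod (q (s ^ 3)) < 1 / 20" if "cmod s < \<rho>" for s
      using q_small[OF cube_less[OF that]] by simp
    have np: "1 + q (s ^ 3) / 2 \<notin> \<real>\<^sub>\<le>\<^sub>0" "1 + 2 * q (s ^ 3) \<notin> \<real>\<^sub>\<le>\<^sub>0" if "cmod s < \<rho>" for s
      using abs_Re_le_cmod[of "q (s ^ 3)"] q3[OF that] by (auto simp: complex_nonpos_Reals_iff)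
    have cont_v: "continuous_on (ball 0 \<rho>) (\<lambda>s. log_mean (cubic_comod (q (s ^ 3))))"
      using deriv_v by (intro continuous_at_imp_continuous_on ballI) (auto dest!: DERIV_isCont)
    have cont_t: "continuous_on (ball 0 \<rho>) (\<lambda>s. log_mean (s ^ 3))"
      by (rule continuous_on_compose2[OF log_mean])
         (use cube_less \<rho>(4) in \<open>force intro!: continuous_intros\<close>)+
    have "continuous_on (ball 0 \<rho>) \<Xi>"
      unfolding \<Xi>_def
      by (intro continuous_intros cont_u cont_rot cont_v cont_t cont_q)
         (use norm_\<omega> np in \<open>auto simp: norm_power\<close>)
    then obtain c where c: "\<And>s. s \<in> ball 0 \<rho> \<Longrightarrow> \<Xi> s = c"
      using DERIV_zero_connected_constant[of "ball 0 \<rho>" "{0}" \<Xi>] deriv_\<Xi> by auto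
    have "c = \<Xi> 0" using c[of 0] \<rho>(1) by simp
    also have "\<Xi> 0 = 0" by (simp add: \<Xi>_def \<psi>(3) q(4))
    finally show ?thesis using c[of s] s by simp
  qed

  \<comment> \<open>The bound \<delta> lets q recover p from t; |t| <= 20 |p| and the bound \<rho>^3
    / 20 place the cube root s of t in the disc of radius \<rho>.\<close>
  define \<epsilon> where "\<epsilon> = Min {1 / 20, \<delta>, \<rho> ^ 3 / 20}"
  show thesis
  proof (rule that[of \<epsilon>])
    show "\<epsilon> > 0" "\<epsilon> \<le> 1 / 20" using q(2) \<rho>(1) by (auto simp: \<epsilon>_def)
    fix p :: complex
    assume p0: "0 < cmod p" and "cmod p < \<epsilon>"
    then have p: "cmod p < 1 / 20" "cmod p < \<delta>" "cmod p < \<rho> ^ 3 / 20" by (auto simp: \<epsilon>_def)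
    define t where "t = cubic_mod p"
    have t: "t \<noteq> 0" "cmod t < \<rho> ^ 3"
      using cubic_bounds(1,2)[OF p(1)] p0 p(3) by (auto simp: t_def)
    define s where "s = exp (Ln t / 3)"
    have s3: "s ^ 3 = t"
      unfolding s_def using t(1) by (subst exp_of_nat_mult[symmetric]) simp
    have s: "cmod s < \<rho>" "s \<noteq> 0"
    proof -
      have "cmod s ^ 3 < \<rho> ^ 3" using t(2) by (simp add: s3 flip: norm_power)
      then show "cmod s < \<rho>" using \<rho>(1) by (intro power_less_imp_less_base[of _ 3 \<rho>]) auto
    qed (simp add: s_def)
    have q_t: "q (s ^ 3) = p" unfolding s3 t_def by (rule q(7)[OF p(2)])
    define P where "P = (\<lambda>c. \<psi> (c * s))"
    define \<Omega> where "\<Omega> = {1, \<omega>, \<omega>\<^sup>2}"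
    have root: "cmod (cubic_mod (P c)) < 1" "cubic_comod (P c) = t" "G3 (cubic_mod (P c)) t = 0"
        "cmod (P c) < \<delta>" "cubic_comod p \<noteq> cubic_mod (P c)" if "c \<in> \<Omega>" for c
    proof -
      have c: "cmod (c * s) < \<rho>" "(c * s) ^ 3 = t"
        using that rotate_small[OF s(1)] rotate_cube s(1) s3 by (auto simp: \<Omega>_def)
      have Pc: "cmod (P c) < 1 / 20" "cmod (P c) < \<delta>"
        using \<psi>_small[OF c(1)] by (simp_all add: P_def)
      show "cmod (cubic_mod (P c)) < 1" by (rule norm_cubic_less_1[OF Pc(1)])
      show comod: "cubic_comod (P c) = t" using \<psi>_cube[OF c(1)] c(2) by (simp add: P_def)
      show "G3 (cubic_mod (P c)) t = 0"
        using G3_cubic[OF small_nonzero(1)[OF Pc(1)]] comod by simp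
      show "cmod (P c) < \<delta>" by fact
      have cube_le: "3 * cmod z ^ 3 \<le> cmod z" if "cmod z < 1 / 20" for z :: complex
      proof -
        have "cmod z ^ 2 \<le> (1 / 20) ^ 2" using that by (intro power_mono) auto
        then have "cmod z * (3 * cmod z ^ 2) \<le> cmod z * 1"
          by (intro mult_left_mono) (auto simp: power2_eq_square)
        then show ?thesis by (simp add: power2_eq_square power3_eq_cube)
      qed
      \<comment> \<open>The root v is smaller in absolute value than each other root: 5 |p| <= |t| =
        |\<open>cubic_comod (P c)\<close>| <= |P c|, hence |v| <= |p| < 5 |P c| <=
        |\<open>cubic_mod (P c)\<close>|.\<close>
      have "5 * cmod p \<le> cmod (P c)"
        using cubic_bounds(1)[OF p(1)] cubic_bounds(3)[OF Pc(1)] cube_le[OF Pc(1)] comod by (simp add: t_def)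
      moreover have "cmod (cubic_comod p) \<le> cmod p"
        using cubic_bounds(3)[OF p(1)] cube_le[OF p(1)] by simp
      ultimately have "cmod (cubic_comod p) < cmod (cubic_mod (P c))"
        using p0 cubic_bounds(1)[OF Pc(1)] by linarith
      then show "cubic_comod p \<noteq> cubic_mod (P c)" by auto
    qed
    have mod_neq: "cubic_mod (P c) \<noteq> cubic_mod (P c')" if "c \<in> \<Omega>" "c' \<in> \<Omega>" "P c \<noteq> P c'" for c c'
      using q(7)[OF root(4)[OF that(1)]] q(7)[OF root(4)[OF that(2)]] that(3) by metis
    have in_\<Omega>: "1 \<in> \<Omega>" "\<omega> \<in> \<Omega>" "\<omega>\<^sup>2 \<in> \<Omega>" by (auto simp: \<Omega>_def)
    have P_neq: "P 1 \<noteq> P \<omega>" "P 1 \<noteq> P (\<omega>\<^sup>2)" "P \<omega> \<noteq> P (\<omega>\<^sup>2)"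
      using distinct[OF s] by (simp_all add: P_def)
    define u0 u1 u2 u3 where "u0 = cubic_comod p" and "u1 = cubic_mod (P 1)" and "u2 = cubic_mod (P \<omega>)"
      and "u3 = cubic_mod (P (\<omega>\<^sup>2))"
    have "card {u0, u1, u2, u3} = 4"
      using root(5)[OF in_\<Omega>(1)] root(5)[OF in_\<Omega>(2)] root(5)[OF in_\<Omega>(3)]
        mod_neq[OF in_\<Omega>(1,2) P_neq(1)] mod_neq[OF in_\<Omega>(1,3) P_neq(2)] mod_neq[OF in_\<Omega>(2,3) P_neq(3)]
      by (simp add: u0_def u1_def u2_def u3_def)
    moreover have G3_expand: "G3 z t = z ^ 4 + (12 * t - 16 * t * (4 * t - 3)\<^sup>2) * z ^ 3
        + (38 * t\<^sup>2 - 32 * t * (4 * t - 3) * (4 - 3 * t)) * z\<^sup>2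
        + (12 * t ^ 3 - 16 * t * (4 - 3 * t)\<^sup>2) * z + t ^ 4" for z
      unfolding G3_def by algebra
    moreover have "G3 z t = 0" if "z \<in> {u0, u1, u2, u3}" for z
    proof -
      \<comment> \<open>In the parametrisation of the curve, t is the first coordinate for the root
        v and the second one for the three others; the symmetry of \<open>G3\<close> reconciles the
        two.\<close>
      have "G3 u0 t = G3 t u0" unfolding G3_def by algebra
      then have "G3 u0 t = 0"
        using G3_cubic[OF small_nonzero(1)[OF p(1)]] by (simp add: u0_def t_def)
      then show ?thesis using that root(3) in_\<Omega> by (auto simp: u1_def u2_def u3_def)
    qed
    ultimately have "G3 z t = (z - u0) * (z - u1) * (z - u2) * (z - u3)" for z
      unfolding G3_expand by (intro monic_quartic_factor)
    moreover have "log_mean u1 + log_mean u2 + log_mean u3 =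
          3 * log_mean (cubic_comod p) - 8 * log_mean (cubic_mod p) + 32 * Ln (1 + p / 2) - 32 * Ln (1 + 2 * p)"
    proof -
      have "\<Xi> s = log_mean u1 + log_mean u2 + log_mean u3 - 3 * log_mean (cubic_comod p) + 8 * log_mean (cubic_mod p)
          - 32 * Ln (1 + p / 2) + 32 * Ln (1 + 2 * p)"
        unfolding \<Xi>_def q_t by (simp add: s3 t_def u1_def u2_def u3_def P_def)
      then show ?thesis using \<Xi>_0[OF s(1)] by (simp add: algebra_simps)
    qed
    ultimately show "\<exists>u1 u2 u3. cmod u1 < 1 \<and> cmod u2 < 1 \<and> cmod u3 < 1 \<and>
        (\<forall>z. G3 z (cubic_mod p) = (z - cubic_comod p) * (z - u1) * (z - u2) * (z - u3)) \<and>
        log_mean u1 + log_mean u2 + log_mean u3 =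
          3 * log_mean (cubic_comod p) - 8 * log_mean (cubic_mod p) + 32 * Ln (1 + p / 2) - 32 * Ln (1 + 2 * p)"
      using root(1) in_\<Omega> unfolding u0_def t_def
      by (intro exI[of _ u1] exI[of _ u2] exI[of _ u3]) (simp add: u1_def u2_def u3_def)
  qed
qed

subsection \<open>Mahler measures\<close>

text \<open>The reciprocal symmetry is (a b)^4 G3(1/a, 1/b) = G3(a, b). It is applied with 1/a in
  the first place, so a = 0 is a separate case.\<close>

lemma G3_inverse:
  assumes t: "t \<noteq> 0" and G: "\<And>z. G3 z t = (z - u0) * (z - u1) * (z - u2) * (z - u3)"
  shows "t ^ 4 * G3 a (inverse t) = (1 - u0 * a) * (1 - u1 * a) * (1 - u2 * a) * (1 - u3 * a)"
proof (cases "a = 0")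
  case True
  then show ?thesis using t by (simp add: G3_def flip: power_mult power_mult_distrib)
next
  case False
  define b where "b = inverse a"
  define i where "i = inverse t"
  have b: "b * a = 1" and i: "i * t = 1" using False t by (simp_all add: b_def i_def)
  have "t ^ 4 * G3 a i = a ^ 4 * G3 b t"
    unfolding G3_def using b i by algebra
  also have "\<dots> = (1 - u0 * a) * (1 - u1 * a) * (1 - u2 * a) * (1 - u3 * a)"
    unfolding G using b by algebra
  finally show ?thesis by (simp add: i_def)
qed

lemma mahler2_G3:
  assumes t: "t \<noteq> 0" and G: "\<And>z. G3 z t = (z - u0) * (z - u1) * (z - u2) * (z - u3)"
    and u: "cmod u0 < 1" "cmod u1 < 1" "cmod u2 < 1" "cmod u3 < 1"
  shows "mahler2 (\<lambda>x y. G3 ((x + inverse x)^2 * (y + inverse y)^2 / 16) (inverse t)) =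
    Re (log_mean u0 + log_mean u1 + log_mean u2 + log_mean u3) - 4 * ln (cmod t)"
proof -
  define a where "a = (\<lambda>s. (cos (2 * pi * fst s))\<^sup>2 * (cos (2 * pi * snd s))\<^sup>2)"
  define L where "L = (\<lambda>u s. ln (cmod (1 - u * of_real (a s))))"
  have cis2: "cis x + inverse (cis x) = of_real (2 * cos x)" for x
    by (simp add: complex_eq_iff)
  have a_eq: "(cis (2 * pi * fst s) + inverse (cis (2 * pi * fst s)))\<^sup>2 *
      (cis (2 * pi * snd s) + inverse (cis (2 * pi * snd s)))\<^sup>2 / 16 = of_real (a s)" for s
    unfolding cis2 by (simp add: a_def power_mult_distrib)
  have a_le: "\<bar>a s\<bar> \<le> 1" for s
    unfolding a_def by (simp add: abs_mult abs_square_le_1 mult_le_one)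
  have nz: "cmod (1 - u * of_real (a s)) > 0" if "cmod u < 1" for u s
  proof -
    have "cmod (u * of_real (a s)) \<le> cmod u * 1"
      unfolding norm_mult using a_le[of s] by (intro mult_left_mono) auto
    with that have "1 \<noteq> u * of_real (a s)" by force
    then show ?thesis by simp
  qed
  have ln_G3: "ln (cmod (G3 (of_real (a s)) (inverse t))) = L u0 s + L u1 s + L u2 s + L u3 s - 4 * ln (cmod t)" for s
  proof -
    have "cmod (t ^ 4 * G3 (of_real (a s)) (inverse t)) = cmod (1 - u0 * of_real (a s)) *
        cmod (1 - u1 * of_real (a s)) * cmod (1 - u2 * of_real (a s)) * cmod (1 - u3 * of_real (a s))"
      unfolding G3_inverse[OF t G] by (simp only: norm_mult)
    then have "cmod (G3 (of_real (a s)) (inverse t)) = cmod (1 - u0 * of_real (a s)) *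
        cmod (1 - u1 * of_real (a s)) * cmod (1 - u2 * of_real (a s)) * cmod (1 - u3 * of_real (a s)) / cmod t ^ 4"
      using t by (simp add: norm_mult norm_power eq_divide_eq mult.commute)
    then show ?thesis
      unfolding L_def using nz[OF u(1), of s] nz[OF u(2), of s] nz[OF u(3), of s] nz[OF u(4), of s] t
      by (simp only:) (simp add: ln_div ln_mult ln_realpow)
  qed
  have int: "set_integrable lborel unit_square (L u)" "(LINT s:unit_square|lborel. L u s) = Re (log_mean u)"
    if "cmod u < 1" for u
    using integral_ln_cos_prod[OF that] by (simp_all add: L_def a_def)
  have "mahler2 (\<lambda>x y. G3 ((x + inverse x)^2 * (y + inverse y)^2 / 16) (inverse t)) =
      (LINT s:unit_square|lborel. L u0 s + L u1 s + L u2 s + L u3 s - 4 * ln (cmod t))"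
    unfolding mahler2_def a_eq ln_G3 ..
  also have "\<dots> = (LINT s:unit_square|lborel. L u0 s) + (LINT s:unit_square|lborel. L u1 s)
      + (LINT s:unit_square|lborel. L u2 s) + (LINT s:unit_square|lborel. L u3 s) - 4 * ln (cmod t)"
    using int(1) u set_integrable_unit_square[OF continuous_on_const, of "4 * ln (cmod t)"]
    by (simp only: set_integral_diff set_integral_add set_integral_unit_square_const)
  also have "\<dots> = Re (log_mean u0 + log_mean u1 + log_mean u2 + log_mean u3) - 4 * ln (cmod t)"
    using int(2) u by simp
  finally show ?thesis .
qed

theorem mainTheorem11:
  shows "\<exists>\<epsilon>>0. \<forall>p::complex. 0 < cmod p \<and> cmod p < \<epsilon> \<longrightarrow>
    mahler2 (\<lambda>x y. G3 ((x + inverse x)^2 * (y + inverse y)^2 / 16)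
                       ((1 / p) * ((1 + 2*p) / (2 + p))^3))
    = - 16 * ln 2 - 16 * mu (p * ((2 + p) / (1 + 2*p))^3)
      + 8 * mu (p^3 * ((2 + p) / (1 + 2*p)))"
proof -
  obtain \<epsilon> where \<epsilon>: "\<epsilon> > 0" "\<epsilon> \<le> 1 / 20"
    and hecke: "\<And>p. 0 < cmod p \<Longrightarrow> cmod p < \<epsilon> \<Longrightarrow>
      \<exists>u1 u2 u3. cmod u1 < 1 \<and> cmod u2 < 1 \<and> cmod u3 < 1 \<and>
        (\<forall>z. G3 z (cubic_mod p) = (z - cubic_comod p) * (z - u1) * (z - u2) * (z - u3)) \<and>
        log_mean u1 + log_mean u2 + log_mean u3 =
          3 * log_mean (cubic_comod p) - 8 * log_mean (cubic_mod p) + 32 * Ln (1 + p / 2) - 32 * Ln (1 + 2 * p)"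
    using log_mean_hecke_3 by blast
  show ?thesis
  proof (intro exI[of _ \<epsilon>] conjI allI impI)
    fix p :: complex assume "0 < cmod p \<and> cmod p < \<epsilon>"
    then have p: "0 < cmod p" "cmod p < \<epsilon>" "cmod p < 1 / 20" using \<epsilon> by auto
    note nz = small_nonzero[OF p(3)]
    obtain u1 u2 u3 where u: "cmod u1 < 1" "cmod u2 < 1" "cmod u3 < 1"
      and G: "\<And>z. G3 z (cubic_mod p) = (z - cubic_comod p) * (z - u1) * (z - u2) * (z - u3)"
      and H: "log_mean u1 + log_mean u2 + log_mean u3 =
          3 * log_mean (cubic_comod p) - 8 * log_mean (cubic_mod p) + 32 * Ln (1 + p / 2) - 32 * Ln (1 + 2 * p)"
      using hecke[OF p(1,2)] by blast
    define t where "t = cubic_mod p"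
    define v where "v = cubic_comod p"
    have t_eq: "p * ((2 + p) / (1 + 2 * p)) ^ 3 = t" and v_eq: "p ^ 3 * ((2 + p) / (1 + 2 * p)) = v"
      by (simp_all add: t_def v_def cubic_mod_def cubic_comod_def power_divide)
    have inv_eq: "1 / p * ((1 + 2 * p) / (2 + p)) ^ 3 = inverse t"
      using nz by (simp add: t_def cubic_mod_def power_divide divide_simps)
    have t: "t \<noteq> 0" "cmod t < 1" and v: "v \<noteq> 0" "cmod v < 1"
      using p(1) nz norm_cubic_less_1[OF p(3)] by (auto simp: t_def v_def cubic_mod_def cubic_comod_def)
    have lnt: "ln (cmod t) = ln (cmod p) + 3 * ln (cmod (2 + p)) - 3 * ln (cmod (1 + 2 * p))"
      using p(1) nz by (simp add: t_def cubic_mod_def norm_divide norm_mult norm_power ln_div ln_mult ln_realpow)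
    have lnv: "ln (cmod v) = 3 * ln (cmod p) + ln (cmod (2 + p)) - ln (cmod (1 + 2 * p))"
      using p(1) nz by (simp add: v_def cubic_comod_def norm_divide norm_mult norm_power ln_div ln_mult ln_realpow)
    have half: "1 + p / 2 = (2 + p) / 2" by (simp add: field_simps)
    have Ln1: "Re (Ln (1 + p / 2)) = ln (cmod (2 + p)) - ln 2"
      unfolding half using nz by (subst Re_Ln) (auto simp: norm_divide ln_div)
    have Ln2: "Re (Ln (1 + 2 * p)) = ln (cmod (1 + 2 * p))"
      using nz by (simp add: Re_Ln)
    have "Re (log_mean u1 + log_mean u2 + log_mean u3) =
        Re (3 * log_mean v - 8 * log_mean t + 32 * Ln (1 + p / 2) - 32 * Ln (1 + 2 * p))"
      unfolding H t_def v_def ..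
    then have "Re (log_mean u1) + Re (log_mean u2) + Re (log_mean u3) =
        3 * Re (log_mean v) - 8 * Re (log_mean t) + 32 * (ln (cmod (2 + p)) - ln 2) - 32 * ln (cmod (1 + 2 * p))"
      using Ln1 Ln2 by simp
    \<comment> \<open>What remains is bookkeeping: 12 ln |t| - 4 ln |v| = 32 (ln |2 + p| - ln |1 +
      2p|), and the constants -16 ln 2 - 16 ln 4 + 8 ln 4 of the right-hand side add up to the -32
      ln 2 contributed by \<open>Ln (1 + p / 2)\<close>.\<close>
    moreover have "ln 4 = 2 * ln (2 :: real)"
      using ln_realpow[of 2 2] by simp
    ultimately show "mahler2 (\<lambda>x y. G3 ((x + inverse x)^2 * (y + inverse y)^2 / 16)
                       ((1 / p) * ((1 + 2*p) / (2 + p))^3))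
    = - 16 * ln 2 - 16 * mu (p * ((2 + p) / (1 + 2*p))^3)
      + 8 * mu (p^3 * ((2 + p) / (1 + 2*p)))"
      unfolding t_eq v_eq inv_eq mu_eq[OF t] mu_eq[OF v] mahler2_G3[OF t(1) G[folded t_def v_def] v(2) u] lnt lnv
        plus_complex.sel
      by (simp add: field_simps)
  qed (rule \<epsilon>(1))
qed

end
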